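(* If $P$ is a set of $n$ points in convex position (and in general position) in the plane, then any convex hull thrackle $C(\mathcal{S})$ on $P$ has at most $n$ convex hulls, i.e. $|\mathcal{S}|\le n$.
   Context: Points are in general position if no three are collinear. Given a set $P$ of $n$ points in general position in the plane and a family $\mathcal{S}$ of subsets of $P$ whose convex hulls are pairwise different, let $C(\mathcal{S})=\{\mathrm{Conv}(S):S\in\mathcal{S}\}$, where $\mathrm{Conv}(S)$ is the convex hull of $S$. $C(\mathcal{S})$ is a convex hull thrackle on $P$ if: (1) $C_1\not\subset C_2$ for any two different $C_1,C_2\in C(\mathcal{S})$; (2) $C_1\cap C_2\neq\emptyset$ for any two different $C_1,C_2\in C(\mathcal{S})$; (3) $C_1\cap C_2\cap C_3\subset P$ for any three different $C_1,C_2,C_3\in C(\mathcal{S})$. *)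

theory Defs
  imports "HOL-Analysis.Analysis"
begin

definition general_position :: "(real ^ 2) set \<Rightarrow> bool" where
  "general_position P \<longleftrightarrow> (\<forall>T\<subseteq>P. card T = 3 \<longrightarrow> \<not> collinear T)"

definition convex_position :: "(real ^ 2) set \<Rightarrow> bool" where
  "convex_position P \<longleftrightarrow> (\<forall>p\<in>P. p \<notin> convex hull (P - {p}))"

definition hulls :: "(real ^ 2) set set \<Rightarrow> (real ^ 2) set set" where
  "hulls \<S> = {convex hull S | S. S \<in> \<S>}"

text \<open>The hypotheses on the family \<open>\<S>\<close> (its members are subsets of \<open>P\<close> with pairwise different
  hulls) are bundled with the three thrackle conditions on the hulls.\<close>

definition convex_hull_thrackle :: "(real ^ 2) set \<Rightarrow> (real ^ 2) set set \<Rightarrow> bool" where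
  "convex_hull_thrackle P \<S> \<longleftrightarrow>
     (\<forall>S\<in>\<S>. S \<subseteq> P) \<and>
     (\<forall>S\<in>\<S>. \<forall>T\<in>\<S>. S \<noteq> T \<longrightarrow> convex hull S \<noteq> convex hull T) \<and>
     (\<forall>C1\<in>hulls \<S>. \<forall>C2\<in>hulls \<S>. C1 \<noteq> C2 \<longrightarrow> \<not> C1 \<subseteq> C2) \<and>
     (\<forall>C1\<in>hulls \<S>. \<forall>C2\<in>hulls \<S>. C1 \<noteq> C2 \<longrightarrow> C1 \<inter> C2 \<noteq> {}) \<and>
     (\<forall>C1\<in>hulls \<S>. \<forall>C2\<in>hulls \<S>. \<forall>C3\<in>hulls \<S>.
        C1 \<noteq> C2 \<and> C1 \<noteq> C3 \<and> C2 \<noteq> C3 \<longrightarrow> C1 \<inter> C2 \<inter> C3 \<subseteq> P)"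

end

theory Submission
  imports Defs
begin

text \<open>Number the points of \<open>P\<close> along their convex hull. Two hulls can only meet if the vertex
  sets share a point or have crossing chords, and three hulls share a point outside \<open>P\<close> as soon
  as they contain a common germ of a chord at one of its endpoints, or two of them contain crossing
  chords whose crossing lies in the third. The resulting combinatorial thrackles are treated by
  induction on the number of points plus the total size of the members. If \<open>S - {x}\<close> still touches
  all other members, then either it may replace \<open>S\<close>, or it lies in a second member \<open>T\<close>; in the
  latter case every other member meets \<open>S - {x}\<close> in one vertex only, and the family is a star or
  can be reduced to a smaller one. If no point can be deleted, all members are edges and triangles,
  no edge ends at a triangle vertex, and every point is on at most two triangles; the edges are
  counted by Perles' argument.\<close>

subsection \<open>Thrackles on cyclically ordered integers\<close>

text \<open>Both triple conditions only forbid configurations, and a configuration inside subsets is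
  one inside the original members. Passing to smaller members therefore endangers nothing but the
  antichain condition and the pairwise touching, which makes an induction on the size of the members
  possible. The obstacle is the antichain condition: if \<open>S - {x}\<close> lies in
  \<open>T\<close>, it cannot replace \<open>S\<close>. But then each chord of
  \<open>S - {x}\<close> is in two hulls, so a third member can neither cross it nor contain both
  its ends. Two members that meet \<open>S - {x}\<close> in different points then lie on the same
  side of the chord between these points, and force every member other than \<open>S\<close> and
  \<open>T\<close> onto that side. This frees either a point beyond the chord, which pays for
  dropping \<open>T\<close>, or room to shrink both \<open>S\<close> and \<open>T\<close>. The bound
  is stated for any finite \<open>V\<close> covering the members, so that such a point may be
  deleted from \<open>V\<close>. In the irreducible case edges and triangles use disjoint sets of
  points, so the bounds for the two kinds add up.\<close>

definition cyc :: "int \<Rightarrow> int \<Rightarrow> int \<Rightarrow> bool" where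
  "cyc a b c \<longleftrightarrow> a < b \<and> b < c \<or> b < c \<and> c < a \<or> c < a \<and> a < b"

definition chords_cross :: "int set \<Rightarrow> int set \<Rightarrow> bool" where
  "chords_cross S T \<longleftrightarrow> (\<exists>a\<in>S. \<exists>c\<in>S. \<exists>b\<in>T. \<exists>d\<in>T. cyc a b c \<and> cyc c d a)"

definition touch :: "int set \<Rightarrow> int set \<Rightarrow> bool" where
  "touch S T \<longleftrightarrow> S \<inter> T \<noteq> {} \<or> chords_cross S T"

definition wedge :: "int \<Rightarrow> int \<Rightarrow> int set \<Rightarrow> bool" where
  "wedge a r S \<longleftrightarrow> a \<in> S \<and> (r \<in> S \<or> (\<exists>u\<in>S. \<exists>v\<in>S. cyc a u r \<and> cyc a r v))"

text \<open>For a hull with vertex set \<open>S\<close>, \<open>wedge a r S\<close> says that the chord from \<open>a\<close> to \<open>r\<close> starts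
  inside the closed angle of the hull at its vertex \<open>a\<close>.\<close>

definition common_germ :: "int set \<Rightarrow> int set \<Rightarrow> int set \<Rightarrow> bool" where
  "common_germ R S T \<longleftrightarrow> (\<exists>a\<in>R. \<exists>r\<in>R. a \<noteq> r \<and> wedge a r S \<and> wedge a r T)"

text \<open>The points come in the cyclic order \<open>p, v, b, r, c, u\<close>. Seen from
  \<open>p\<close>, the chord \<open>b c\<close> lies beyond the chord \<open>u v\<close>, so the
  triangle \<open>p b c\<close> contains the crossing of \<open>p r\<close> with \<open>u v\<close>.
  The alternative \<open>r \<in> S\<close> serves a set shared by two members, the other one an edge
  at a triangle vertex.\<close>

definition common_crossing :: "int set \<Rightarrow> int set \<Rightarrow> int set \<Rightarrow> bool" where
  "common_crossing R S T \<longleftrightarrow> (\<exists>p\<in>R. \<exists>r\<in>R. \<exists>u\<in>T. \<exists>v\<in>T. cyc p v r \<and> cyc r u p \<and> p \<in> S \<and>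
     (r \<in> S \<or> (\<exists>b\<in>S. \<exists>c\<in>S. cyc p v b \<and> cyc p b r \<and> cyc p r c \<and> cyc p c u)))"

definition cyclic_thrackle :: "int set set \<Rightarrow> bool" where
  "cyclic_thrackle F \<longleftrightarrow> {} \<notin> F \<and>
     (\<forall>S\<in>F. \<forall>T\<in>F. S \<noteq> T \<longrightarrow> \<not> S \<subseteq> T \<and> touch S T) \<and>
     (\<forall>R\<in>F. \<forall>S\<in>F. \<forall>T\<in>F. R \<noteq> S \<and> R \<noteq> T \<and> S \<noteq> T \<longrightarrow>
        \<not> common_germ R S T \<and> \<not> common_crossing R S T)"

lemma cyclic_thrackleD:
  assumes "cyclic_thrackle F"
  shows "S \<in> F \<Longrightarrow> S \<noteq> {}"
    and "S \<in> F \<Longrightarrow> T \<in> F \<Longrightarrow> S \<noteq> T \<Longrightarrow> \<not> S \<subseteq> T"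
    and "S \<in> F \<Longrightarrow> T \<in> F \<Longrightarrow> S \<noteq> T \<Longrightarrow> touch S T"
    and "R \<in> F \<Longrightarrow> S \<in> F \<Longrightarrow> T \<in> F \<Longrightarrow> R \<noteq> S \<Longrightarrow> R \<noteq> T \<Longrightarrow> S \<noteq> T \<Longrightarrow> \<not> common_germ R S T"
    and "R \<in> F \<Longrightarrow> S \<in> F \<Longrightarrow> T \<in> F \<Longrightarrow> R \<noteq> S \<Longrightarrow> R \<noteq> T \<Longrightarrow> S \<noteq> T \<Longrightarrow> \<not> common_crossing R S T"
  using assms unfolding cyclic_thrackle_def by metis+

section \<open>Cyclic order and separation by arcs\<close>

lemma cyc_rotate: "cyc a b c \<Longrightarrow> cyc b c a"
  by (auto simp: cyc_def)

lemma cyc_total: "a \<noteq> b \<Longrightarrow> b \<noteq> c \<Longrightarrow> a \<noteq> c \<Longrightarrow> cyc a b c \<or> cyc c b a"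
  by (auto simp: cyc_def)

lemma cyc_irrefl [simp]: "\<not> cyc a a b" "\<not> cyc a b a" "\<not> cyc b a a"
  by (auto simp: cyc_def)

lemma cyc_asym: "cyc a b c \<Longrightarrow> \<not> cyc c b a"
  by (auto simp: cyc_def)

lemma touch_sym: "touch S T \<Longrightarrow> touch T S"
proof -
  have "cyc b c d \<and> cyc d a b" if "cyc a b c" "cyc c d a" for a b c d
    using that unfolding cyc_def by (smt (verit))
  then show "touch S T \<Longrightarrow> touch T S" unfolding touch_def chords_cross_def by blast
qed

lemma touch_shared: "a \<in> S \<Longrightarrow> a \<in> T \<Longrightarrow> touch S T"
  by (auto simp: touch_def)

text \<open>Endpoints of crossing chords alternate around the circle, those of chords in
  complementary arcs do not. Here the arcs are \<open>[a, b)\<close> and \<open>[b, a)\<close>; the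
  two variants below distribute the endpoints differently.\<close>

lemma not_touch_halfopen_arcs:
  assumes "\<And>s. s \<in> S \<Longrightarrow> s = a \<or> cyc a s b" "\<And>t. t \<in> T \<Longrightarrow> t = b \<or> cyc b t a" "a \<noteq> b"
  shows "\<not> touch S T"
proof
  assume "touch S T"
  then consider z where "z \<in> S" "z \<in> T" | p q r s where "p \<in> S" "r \<in> S" "q \<in> T" "s \<in> T" "cyc p q r" "cyc r s p"
    by (auto simp: touch_def chords_cross_def)
  then show False
  proof cases
    case 1
    then show False using assms(1)[of z] assms(2)[of z] assms(3) by (auto simp: cyc_def)
  next
    case 2
    then show False using assms(1)[of p] assms(1)[of r] assms(2)[of q] assms(2)[of s] assms(3)
      unfolding cyc_def by (smt (verit))
  qed
qed

lemma not_touch_halfopen_arcs_right: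
  assumes "\<And>s. s \<in> S \<Longrightarrow> s = b \<or> cyc a s b" "\<And>t. t \<in> T \<Longrightarrow> t = a \<or> cyc b t a" "a \<noteq> b"
  shows "\<not> touch S T"
proof
  assume "touch S T"
  then consider z where "z \<in> S" "z \<in> T" | p q r s where "p \<in> S" "r \<in> S" "q \<in> T" "s \<in> T" "cyc p q r" "cyc r s p"
    by (auto simp: touch_def chords_cross_def)
  then show False
  proof cases
    case 1
    then show False using assms(1)[of z] assms(2)[of z] assms(3) by (auto simp: cyc_def)
  next
    case 2
    then show False using assms(1)[of p] assms(1)[of r] assms(2)[of q] assms(2)[of s] assms(3)
      unfolding cyc_def by (smt (verit))
  qed
qed

lemma not_touch_closed_open_arcs:
  assumes "\<And>s. s \<in> S \<Longrightarrow> s = a \<or> s = b \<or> cyc a s b" "\<And>t. t \<in> T \<Longrightarrow> cyc b t a"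
  shows "\<not> touch S T"
proof
  assume "touch S T"
  then consider z where "z \<in> S" "z \<in> T" | p q r s where "p \<in> S" "r \<in> S" "q \<in> T" "s \<in> T" "cyc p q r" "cyc r s p"
    by (auto simp: touch_def chords_cross_def)
  then show False
  proof cases
    case 1
    then show False using assms(1)[of z] assms(2)[of z] by (auto simp: cyc_def)
  next
    case 2
    then show False using assms(1)[of p] assms(1)[of r] assms(2)[of q] assms(2)[of s]
      unfolding cyc_def by (smt (verit))
  qed
qed

section \<open>Forbidden triples under shrinking of members\<close>

lemma common_germI:
  "a \<in> R \<Longrightarrow> r \<in> R \<Longrightarrow> a \<noteq> r \<Longrightarrow> wedge a r S \<Longrightarrow> wedge a r T \<Longrightarrow> common_germ R S T"
  unfolding common_germ_def by blast

lemma common_crossingI: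
  assumes "p \<in> R" "r \<in> R" "u \<in> T" "v \<in> T" "cyc p v r" "cyc r u p" "p \<in> S"
    "b \<in> S" "c \<in> S" "cyc p v b" "cyc p b r" "cyc p r c" "cyc p c u"
  shows "common_crossing R S T"
  unfolding common_crossing_def using assms by metis

lemma wedge_mono: "wedge a r S \<Longrightarrow> S \<subseteq> S' \<Longrightarrow> wedge a r S'"
  unfolding wedge_def by blast

lemma common_germ_mono:
  "common_germ R S T \<Longrightarrow> R \<subseteq> R' \<Longrightarrow> S \<subseteq> S' \<Longrightarrow> T \<subseteq> T' \<Longrightarrow> common_germ R' S' T'"
  unfolding common_germ_def using wedge_mono by blast

lemma common_crossing_mono:
  "common_crossing R S T \<Longrightarrow> R \<subseteq> R' \<Longrightarrow> S \<subseteq> S' \<Longrightarrow> T \<subseteq> T' \<Longrightarrow> common_crossing R' S' T'"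
proof -
  assume sub: "R \<subseteq> R'" "S \<subseteq> S'" "T \<subseteq> T'" and "common_crossing R S T"
  then obtain p r u v where "p \<in> R" "r \<in> R" "u \<in> T" "v \<in> T" "cyc p v r" "cyc r u p" "p \<in> S"
    and "r \<in> S \<or> (\<exists>b\<in>S. \<exists>c\<in>S. cyc p v b \<and> cyc p b r \<and> cyc p r c \<and> cyc p c u)"
    unfolding common_crossing_def by blast
  moreover from this(8) sub(2) have "r \<in> S' \<or> (\<exists>b\<in>S'. \<exists>c\<in>S'. cyc p v b \<and> cyc p b r \<and> cyc p r c \<and> cyc p c u)"
    by blast
  ultimately show ?thesis using sub unfolding common_crossing_def by blast
qed

text \<open>Germs and crossings inside subsets are germs and crossings of the original members, so
  the triple conditions are inherited and only the pairwise ones have to be supplied. The antichain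
  property of the images also gives injectivity, so no member is lost.\<close>

lemma cyclic_thrackle_shrink:
  assumes F: "cyclic_thrackle F" and "F0 \<subseteq> F"
    and g: "\<And>X. X \<in> F0 \<Longrightarrow> g X \<subseteq> X \<and> g X \<noteq> {}"
    and gg: "\<And>X Y. X \<in> F0 \<Longrightarrow> Y \<in> F0 \<Longrightarrow> X \<noteq> Y \<Longrightarrow> \<not> g X \<subseteq> g Y \<and> touch (g X) (g Y)"
  shows "cyclic_thrackle (g ` F0)" "inj_on g F0"
proof -
  show "inj_on g F0" using gg by (intro inj_onI) blast
  have bad: "\<not> common_germ (g R) (g S) (g T)" "\<not> common_crossing (g R) (g S) (g T)"
    if "R \<in> F0" "S \<in> F0" "T \<in> F0" "R \<noteq> S" "R \<noteq> T" "S \<noteq> T" for R S T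
  proof -
    have sub: "g R \<subseteq> R" "g S \<subseteq> S" "g T \<subseteq> T" using g that by blast+
    have inF: "R \<in> F" "S \<in> F" "T \<in> F" using that \<open>F0 \<subseteq> F\<close> by blast+
    show "\<not> common_germ (g R) (g S) (g T)"
      using cyclic_thrackleD(4)[OF F inF that(4-6)] common_germ_mono[OF _ sub] by blast
    show "\<not> common_crossing (g R) (g S) (g T)"
      using cyclic_thrackleD(5)[OF F inF that(4-6)] common_crossing_mono[OF _ sub] by blast
  qed
  show "cyclic_thrackle (g ` F0)"
    unfolding cyclic_thrackle_def
  proof (intro conjI ballI impI)
    show "{} \<notin> g ` F0" using g by force
  next
    fix X Y assume "X \<in> g ` F0" "Y \<in> g ` F0" "X \<noteq> Y"
    then obtain S T where "X = g S" "Y = g T" "S \<in> F0" "T \<in> F0" "S \<noteq> T" by blast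
    then show "\<not> X \<subseteq> Y" "touch X Y" using gg by simp_all
  next
    fix X Y Z assume "X \<in> g ` F0" "Y \<in> g ` F0" "Z \<in> g ` F0" "X \<noteq> Y \<and> X \<noteq> Z \<and> Y \<noteq> Z"
    then obtain R S T where "X = g R" "Y = g S" "Z = g T" "R \<in> F0" "S \<in> F0" "T \<in> F0" "R \<noteq> S" "R \<noteq> T" "S \<noteq> T"
      by blast
    then show "\<not> common_germ X Y Z" "\<not> common_crossing X Y Z" using bad by simp_all
  qed
qed

text \<open>A set with two or more points has at least two incidences and a point has at most two,
  so double counting gives the bound. A singleton has only one incidence and is given weight 2 for
  it; by the antichain property no other set contains its point, so the weight at that point is
  still 2.\<close>

lemma antichain_multiplicity_two:
  assumes "finite W" "finite G" "\<And>S. S \<in> G \<Longrightarrow> S \<subseteq> W \<and> S \<noteq> {}"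
    and anti: "\<And>S T. S \<in> G \<Longrightarrow> T \<in> G \<Longrightarrow> S \<noteq> T \<Longrightarrow> \<not> S \<subseteq> T"
    and two: "\<And>x R S T. R \<in> G \<Longrightarrow> S \<in> G \<Longrightarrow> T \<in> G \<Longrightarrow> x \<in> R \<Longrightarrow> x \<in> S \<Longrightarrow> x \<in> T \<Longrightarrow> R = S \<or> R = T \<or> S = T"
  shows "card G \<le> card W"
proof -
  let ?w = "\<lambda>x S. if x \<in> S then (if card S = 1 then 2 else 1) else (0::nat)"
  have fin: "finite S" if "S \<in> G" for S using assms(1,3) that finite_subset by blast
  have ge: "2 \<le> (\<Sum>x\<in>W. ?w x S)" if "S \<in> G" for S
  proof -
    have "(\<Sum>x\<in>W. ?w x S) = (\<Sum>x\<in>S. if card S = 1 then 2 else 1)"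
      using assms(3)[OF that] by (intro sum.mono_neutral_cong_right assms(1)) auto
    also have "\<dots> = card S * (if card S = 1 then 2 else 1)" by simp
    also have "\<dots> \<ge> 2" using fin[OF that] assms(3)[OF that]
      by (cases "card S" rule: nat.exhaust) (auto simp: Suc_le_eq)
    finally show ?thesis .
  qed
  have le: "(\<Sum>S\<in>G. ?w x S) \<le> 2" for x
  proof -
    have eq: "(\<Sum>S\<in>G. ?w x S) = (\<Sum>S\<in>{S\<in>G. x \<in> S}. ?w x S)"
      using assms(2) by (intro sum.mono_neutral_right) auto
    show ?thesis
    proof (cases "\<exists>S\<in>G. x \<in> S \<and> card S = 1")
      case True
      then obtain S where S: "S \<in> G" "x \<in> S" "card S = 1" by auto
      then have "S = {x}" by (metis card_1_singletonE singletonD)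
      then have "{S\<in>G. x \<in> S} = {S}" using anti S by blast
      then show ?thesis unfolding eq using S by simp
    next
      case False
      then have "(\<Sum>S\<in>{S\<in>G. x \<in> S}. ?w x S) = card {S\<in>G. x \<in> S}"
        by simp
      also have "\<dots> \<le> 2"
      proof (rule ccontr)
        assume "\<not> ?thesis"
        then have "3 \<le> card {S\<in>G. x \<in> S}" by simp
        then obtain B where "B \<subseteq> {S\<in>G. x \<in> S}" "card B = 3" by (meson obtain_subset_with_card_n)
        then obtain R S T where "B = {R, S, T}" "R \<noteq> S" "R \<noteq> T" "S \<noteq> T" by (auto simp: card_3_iff)
        then show False using two[of R S T x] \<open>B \<subseteq> _\<close> by blast
      qed
      finally show ?thesis unfolding eq .
    qed
  qed
  have "2 * card G \<le> (\<Sum>S\<in>G. \<Sum>x\<in>W. ?w x S)"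
    using sum_mono[of G "\<lambda>_. 2" "\<lambda>S. \<Sum>x\<in>W. ?w x S"] ge by simp
  also have "\<dots> = (\<Sum>x\<in>W. \<Sum>S\<in>G. ?w x S)" by (rule sum.swap)
  also have "\<dots> \<le> 2 * card W"
    using sum_mono[of W "\<lambda>x. \<Sum>S\<in>G. ?w x S" "\<lambda>_. 2"] le by simp
  finally show ?thesis by simp
qed

text \<open>After removal of \<open>q\<close> each point \<open>x\<close> lies in at most two sets,
  since with three the chord from \<open>q\<close> to \<open>x\<close> would be a common germ. If
  \<open>{q}\<close> itself is a member, the antichain condition makes it the only one.\<close>

lemma card_star_le:
  assumes F: "cyclic_thrackle F" and V: "finite V" "\<Union>F \<subseteq> V" and q: "\<And>S. S \<in> F \<Longrightarrow> q \<in> S"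
  shows "card F \<le> card V"
proof (cases "{q} \<in> F")
  case True
  then have "F = {{q}}" using cyclic_thrackleD(2)[OF F True] q by blast
  moreover have "q \<in> V" using True V(2) by blast
  ultimately show ?thesis using V(1) by (simp add: card_gt_0_iff Suc_le_eq) blast
next
  case False
  have inj: "inj_on (\<lambda>S. S - {q}) F"
  proof (rule inj_onI)
    fix S T assume "S \<in> F" "T \<in> F" "S - {q} = T - {q}"
    then show "S = T" using q by blast
  qed
  have finF: "finite F" using V by (metis finite_Pow_iff finite_subset subset_Pow_Union)
  have "card ((\<lambda>S. S - {q}) ` F) \<le> card V"
  proof (rule antichain_multiplicity_two[OF V(1)])
    show "finite ((\<lambda>S. S - {q}) ` F)" using finF by simp
  next
    fix S assume "S \<in> (\<lambda>S. S - {q}) ` F"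
    then obtain S' where S': "S = S' - {q}" "S' \<in> F" by blast
    then have "S' \<noteq> {q}" "q \<in> S'" "S' \<subseteq> V" using False q V(2) by auto
    then show "S \<subseteq> V \<and> S \<noteq> {}" unfolding S' by blast
  next
    fix S T assume "S \<in> (\<lambda>S. S - {q}) ` F" "T \<in> (\<lambda>S. S - {q}) ` F" "S \<noteq> T"
    then obtain S' T' where "S = S' - {q}" "T = T' - {q}" "S' \<in> F" "T' \<in> F" "S' \<noteq> T'" by blast
    then show "\<not> S \<subseteq> T" using cyclic_thrackleD(2)[OF F, of S' T'] q by blast
  next
    fix x R S T assume a: "R \<in> (\<lambda>S. S - {q}) ` F" "S \<in> (\<lambda>S. S - {q}) ` F" "T \<in> (\<lambda>S. S - {q}) ` F"
      "x \<in> R" "x \<in> S" "x \<in> T"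
    then obtain R' S' T' where "R = R' - {q}" "S = S' - {q}" "T = T' - {q}" "R' \<in> F" "S' \<in> F" "T' \<in> F" by blast
    then have x: "x \<in> R'" "x \<in> S'" "x \<in> T'" "x \<noteq> q" using a by blast+
    then have "wedge q x S'" "wedge q x T'" using q \<open>S' \<in> F\<close> \<open>T' \<in> F\<close> by (simp_all add: wedge_def)
    then have "common_germ R' S' T'" using x q[OF \<open>R' \<in> F\<close>] unfolding common_germ_def by metis
    then have "R' = S' \<or> R' = T' \<or> S' = T'"
      using cyclic_thrackleD(4)[OF F \<open>R' \<in> F\<close> \<open>S' \<in> F\<close> \<open>T' \<in> F\<close>] by blast
    then show "R = S \<or> R = T \<or> S = T" using \<open>R = _\<close> \<open>S = _\<close> \<open>T = _\<close> by blast
  qed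
  then show ?thesis using card_image[OF inj] by simp
qed

subsection \<open>Deleting a point from a member\<close>

lemma chord_side:
  assumes n: "\<not> chords_cross A R" and s: "s1 \<in> A" "s2 \<in> A" "s1 \<noteq> s2"
  shows "(\<forall>r\<in>R. r = s1 \<or> r = s2 \<or> cyc s1 r s2) \<or> (\<forall>r\<in>R. r = s1 \<or> r = s2 \<or> cyc s2 r s1)"
proof (rule ccontr)
  assume "\<not> ?thesis"
  then obtain r r' where r: "r \<in> R" "r' \<in> R" "r \<noteq> s1" "r \<noteq> s2" "r' \<noteq> s1" "r' \<noteq> s2"
    "\<not> cyc s1 r s2" "\<not> cyc s2 r' s1" by blast
  then have "cyc s2 r s1" "cyc s1 r' s2" using cyc_total[of s1 r s2] cyc_total[of s1 r' s2] s(3) by metis+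
  then show False using n r s unfolding chords_cross_def by blast
qed

text \<open>Each of \<open>R1\<close> and \<open>R2\<close> stays on one side of the chord
  \<open>s1 s2\<close>. On opposite sides they would lie in complementary half-open arcs and not
  touch.\<close>

lemma facing_arcs:
  assumes nc: "\<not> chords_cross A R1" "\<not> chords_cross A R2"
    and i: "R1 \<inter> A = {s1}" "R2 \<inter> A = {s2}" and ne: "s1 \<noteq> s2" and t: "touch R1 R2"
  shows "(\<forall>r\<in>R1. r = s1 \<or> cyc s1 r s2) \<and> (\<forall>r\<in>R2. r = s2 \<or> cyc s1 r s2)
       \<or> (\<forall>r\<in>R1. r = s1 \<or> cyc s2 r s1) \<and> (\<forall>r\<in>R2. r = s2 \<or> cyc s2 r s1)"
proof -
  have sA: "s1 \<in> A" "s2 \<in> A" using i by blast+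
  have sR: "s1 \<notin> R2" "s2 \<notin> R1" using i sA ne by (metis IntI singletonD)+
  have 1: "(\<forall>r\<in>R1. r = s1 \<or> cyc s1 r s2) \<or> (\<forall>r\<in>R1. r = s1 \<or> cyc s2 r s1)"
    using chord_side[OF nc(1) sA ne] sR(2) by metis
  have 2: "(\<forall>r\<in>R2. r = s2 \<or> cyc s1 r s2) \<or> (\<forall>r\<in>R2. r = s2 \<or> cyc s2 r s1)"
    using chord_side[OF nc(2) sA ne] sR(1) by metis
  have 3: False if "\<forall>r\<in>R1. r = s1 \<or> cyc s1 r s2" "\<forall>r\<in>R2. r = s2 \<or> cyc s2 r s1"
    using not_touch_halfopen_arcs[of R1 s1 s2 R2, OF _ _ ne] t that by simp
  have 4: False if "\<forall>r\<in>R1. r = s1 \<or> cyc s2 r s1" "\<forall>r\<in>R2. r = s2 \<or> cyc s1 r s2"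
    using not_touch_halfopen_arcs_right[of R1 s1 s2 R2] ne t that by simp
  show ?thesis
    using 1 2
  proof (elim disjE)
    assume "\<forall>r\<in>R1. r = s1 \<or> cyc s1 r s2" "\<forall>r\<in>R2. r = s2 \<or> cyc s1 r s2"
    then show ?thesis by simp
  next
    assume "\<forall>r\<in>R1. r = s1 \<or> cyc s2 r s1" "\<forall>r\<in>R2. r = s2 \<or> cyc s2 r s1"
    then show ?thesis by simp
  qed (use 3 4 in simp_all)
qed

section \<open>Shrinking members inside the induction\<close>

lemma finite_family:
  assumes "finite V" "\<Union>F \<subseteq> V"
  shows "finite F"
  using assms by (metis finite_Pow_iff finite_subset subset_Pow_Union)

abbreviation total_size :: "int set set \<Rightarrow> nat" where
  "total_size F \<equiv> (\<Sum>X\<in>F. card X)"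

lemma total_size_shrink_less:
  assumes "finite V" "\<Union>F \<subseteq> V" "F0 \<subseteq> F" "inj_on g F0" "\<And>X. X \<in> F0 \<Longrightarrow> g X \<subseteq> X"
    and "S \<in> F0" "g S \<subset> S"
  shows "total_size (g ` F0) < total_size F"
proof -
  have finX: "finite X" if "X \<in> F" for X using assms(1,2) that by (meson Union_upper finite_subset)
  have finF: "finite F" using finite_family assms(1,2) by blast
  then have finF0: "finite F0" using assms(3) finite_subset by blast
  have "total_size (g ` F0) = (\<Sum>X\<in>F0. card (g X))" using assms(4) by (simp add: sum.reindex)
  also have "\<dots> < (\<Sum>X\<in>F0. card X)"
  proof (rule sum_strict_mono_ex1[OF finF0])
    have fin: "finite X" if "X \<in> F0" for X using finX that assms(3) by blast
    show "\<forall>X\<in>F0. card (g X) \<le> card X"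
    proof
      fix X assume "X \<in> F0"
      then show "card (g X) \<le> card X" by (intro card_mono fin assms(5))
    qed
    show "\<exists>X\<in>F0. card (g X) < card X"
      using psubset_card_mono[OF fin[OF assms(6)] assms(7)] assms(6) by blast
  qed
  also have "\<dots> \<le> total_size F" by (rule sum_mono2[OF finF assms(3)]) simp
  finally show ?thesis .
qed

text \<open>The induction hypothesis applies to the shrunken family even if \<open>V' = V\<close>,
  because the proper shrinking of \<open>S\<close> lowers the total size. Since \<open>F0\<close>
  and \<open>V'\<close> may be smaller than \<open>F\<close> and \<open>V\<close>, this also covers
  dropping a member together with a point.\<close>

lemma card_le_if_shrinkable:
  assumes F: "cyclic_thrackle F" and V: "finite V" "\<Union>F \<subseteq> V"
    and IH: "\<And>F' V'. cyclic_thrackle F' \<Longrightarrow> finite V' \<Longrightarrow> \<Union>F' \<subseteq> V' \<Longrightarrow>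
      card V' + total_size F' < card V + total_size F \<Longrightarrow> card F' \<le> card V'"
    and F0: "F0 \<subseteq> F"
    and g: "\<And>X. X \<in> F0 \<Longrightarrow> g X \<subseteq> X \<and> g X \<noteq> {}"
    and gg: "\<And>X Y. X \<in> F0 \<Longrightarrow> Y \<in> F0 \<Longrightarrow> X \<noteq> Y \<Longrightarrow> \<not> g X \<subseteq> g Y \<and> touch (g X) (g Y)"
    and S: "S \<in> F0" "g S \<subset> S"
    and V': "V' \<subseteq> V" "\<And>X. X \<in> F0 \<Longrightarrow> g X \<subseteq> V'"
  shows "card F0 \<le> card V'"
proof -
  have thr: "cyclic_thrackle (g ` F0)" and inj: "inj_on g F0"
    using cyclic_thrackle_shrink[OF F F0 g gg] by blast+
  have "total_size (g ` F0) < total_size F"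
    using total_size_shrink_less[OF V F0 inj _ S] g by blast
  moreover have "card V' \<le> card V" using card_mono[OF V(1) V'(1)] .
  ultimately have "card V' + total_size (g ` F0) < card V + total_size F" by simp
  then have "card (g ` F0) \<le> card V'"
    using IH[OF thr finite_subset[OF V'(1) V(1)]] V'(2) by blast
  then show ?thesis using card_image[OF inj] by simp
qed

lemma card_le_if_two_shrinkable:
  assumes F: "cyclic_thrackle F" and V: "finite V" "\<Union>F \<subseteq> V"
    and IH: "\<And>F' V'. cyclic_thrackle F' \<Longrightarrow> finite V' \<Longrightarrow> \<Union>F' \<subseteq> V' \<Longrightarrow>
      card V' + total_size F' < card V + total_size F \<Longrightarrow> card F' \<le> card V'"
    and ST: "S \<in> F" "T \<in> F" "S \<noteq> T" and S': "S' \<subset> S" "S' \<noteq> {}" and T': "T' \<subseteq> T" "T' \<noteq> {}"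
    and ST': "\<not> S' \<subseteq> T'" "\<not> T' \<subseteq> S'" "touch S' T'"
    and RS: "\<And>R. R \<in> F - {S, T} \<Longrightarrow> \<not> S' \<subseteq> R \<and> \<not> R \<subseteq> S' \<and> touch S' R"
    and RT: "\<And>R. R \<in> F - {S, T} \<Longrightarrow> \<not> T' \<subseteq> R \<and> \<not> R \<subseteq> T' \<and> touch T' R"
  shows "card F \<le> card V"
proof (rule card_le_if_shrinkable[OF F V IH order_refl, of "\<lambda>X. if X = S then S' else if X = T then T' else X" S])
  let ?g = "\<lambda>X. if X = S then S' else if X = T then T' else X"
  show "?g X \<subseteq> X \<and> ?g X \<noteq> {}" if "X \<in> F" for X
    using that S' T' cyclic_thrackleD(1)[OF F that] by auto
  show "?g X \<subseteq> V" if "X \<in> F" for X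
    using that S'(1) T'(1) V(2) by auto
  have g: "?g S = S'" "?g T = T'" "\<And>R. R \<in> F - {S, T} \<Longrightarrow> ?g R = R" using ST(3) by simp_all
  show "\<not> ?g X \<subseteq> ?g Y \<and> touch (?g X) (?g Y)" if XY: "X \<in> F" "Y \<in> F" "X \<noteq> Y" for X Y
  proof -
    consider "X = S" "Y = T" | "X = T" "Y = S" | "X = S" "Y \<in> F - {S, T}" | "X = T" "Y \<in> F - {S, T}"
      | "X \<in> F - {S, T}" "Y = S" | "X \<in> F - {S, T}" "Y = T" | "X \<in> F - {S, T}" "Y \<in> F - {S, T}"
      using XY by (cases "X = S"; cases "X = T"; cases "Y = S"; cases "Y = T") simp_all
    then show ?thesis
    proof cases
      case 1
      then show ?thesis unfolding 1 g using ST' by blast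
    next
      case 2
      then show ?thesis unfolding 2 g using ST' touch_sym by blast
    next
      case 3
      then show ?thesis unfolding g(3)[OF 3(2)] unfolding 3(1) g using RS[OF 3(2)] by blast
    next
      case 4
      then show ?thesis unfolding g(3)[OF 4(2)] unfolding 4(1) g using RT[OF 4(2)] by blast
    next
      case 5
      then show ?thesis unfolding g(3)[OF 5(1)] unfolding 5(2) g using RS[OF 5(1)] touch_sym by blast
    next
      case 6
      then show ?thesis unfolding g(3)[OF 6(1)] unfolding 6(2) g using RT[OF 6(1)] touch_sym by blast
    next
      case 7
      then show ?thesis unfolding g(3)[OF 7(1)] g(3)[OF 7(2)] using cyclic_thrackleD(2,3)[OF F XY] by blast
    qed
  qed
qed (use ST S' in auto)

lemma card_le_if_removable_point:
  assumes F: "cyclic_thrackle F" and V: "finite V" "\<Union>F \<subseteq> V"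
    and IH: "\<And>F' V'. cyclic_thrackle F' \<Longrightarrow> finite V' \<Longrightarrow> \<Union>F' \<subseteq> V' \<Longrightarrow>
      card V' + total_size F' < card V + total_size F \<Longrightarrow> card F' \<le> card V'"
    and S: "S \<in> F" "x \<in> S" and many: "F \<noteq> {S}"
    and tch: "\<And>T. T \<in> F \<Longrightarrow> T \<noteq> S \<Longrightarrow> touch (S - {x}) T"
  shows "card F \<le> card V"
proof (cases "\<exists>T\<in>F. T \<noteq> S \<and> S - {x} \<subseteq> T")
  case False
  have ne: "S - {x} \<noteq> {}"
  proof -
    obtain T where "T \<in> F" "T \<noteq> S" using many S(1) by blast
    from tch[OF this] show ?thesis by (auto simp: touch_def chords_cross_def)
  qed
  show ?thesis
  proof (rule card_le_if_shrinkable[OF F V IH order_refl, of "\<lambda>X. if X = S then S - {x} else X" S])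
    show "(if X = S then S - {x} else X) \<subseteq> X \<and> (if X = S then S - {x} else X) \<noteq> {}" if "X \<in> F" for X
      using that ne cyclic_thrackleD(1)[OF F] by auto
    show "\<not> (if X = S then S - {x} else X) \<subseteq> (if Y = S then S - {x} else Y) \<and>
        touch (if X = S then S - {x} else X) (if Y = S then S - {x} else Y)"
      if "X \<in> F" "Y \<in> F" "X \<noteq> Y" for X Y
      using that cyclic_thrackleD(2,3)[OF F that] tch touch_sym[OF tch[of X]] False by auto
    show "(if X = S then S - {x} else X) \<subseteq> V" if "X \<in> F" for X using that V(2) by auto
  qed (use S in auto)
next
  case True
  then obtain T where T: "T \<in> F" "T \<noteq> S" "S - {x} \<subseteq> T" by blast
  define A where "A = S - {x}"
  have A: "A \<subseteq> S" "A \<subseteq> T" using T by (auto simp: A_def)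
  have SA: "S = insert x A" using S by (auto simp: A_def)
  have xT: "x \<notin> T" using cyclic_thrackleD(2)[OF F S(1) T(1)] T SA A by blast
  define \<R> where "\<R> = F - {S, T}"
  have R: "R \<in> F" "R \<noteq> S" "R \<noteq> T" if "R \<in> \<R>" for R using that by (auto simp: \<R>_def)
  \<comment> \<open>Chords of \<open>A\<close> belong to both \<open>S\<close> and \<open>T\<close>,
    so crossing one produces a forbidden triple. Likewise two points of \<open>R\<close> in
    \<open>A\<close> would give a common germ; hence \<open>R\<close> meets \<open>A\<close> in
    exactly one point.\<close>
  have nc: "\<not> chords_cross A R" if "R \<in> \<R>" for R
  proof
    assume "chords_cross A R"
    then obtain a b c d where "a \<in> A" "c \<in> A" "b \<in> R" "d \<in> R" "cyc a b c" "cyc c d a"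
      unfolding chords_cross_def by blast
    then have "common_crossing S T R" using A unfolding common_crossing_def by blast
    then show False using cyclic_thrackleD(5)[OF F S(1) T(1) R(1)[OF that]] R[OF that] T by blast
  qed
  have wA: "\<exists>s. R \<inter> A = {s}" if "R \<in> \<R>" for R
  proof -
    have "R \<inter> A \<noteq> {}"
      using tch[OF R(1,2)[OF that]] nc[OF that] by (auto simp: touch_def A_def)
    moreover have "a = c" if "a \<in> R \<inter> A" "c \<in> R \<inter> A" for a c
    proof (rule ccontr)
      assume "a \<noteq> c"
      then have "common_germ R S T" using that A unfolding common_germ_def wedge_def by blast
      then show False using cyclic_thrackleD(4)[OF F R(1)[OF \<open>R \<in> \<R>\<close>] S(1) T(1)] R[OF \<open>R \<in> \<R>\<close>] T by blast
    qed
    ultimately show ?thesis by blast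
  qed
  have neA: "A \<noteq> {}"
    using tch[OF T(1,2)] by (auto simp: touch_def chords_cross_def A_def)
  show ?thesis
  proof (cases "\<exists>q\<in>A. \<forall>R\<in>\<R>. q \<in> R")
    case True
    then obtain q where q: "q \<in> A" "\<And>R. R \<in> \<R> \<Longrightarrow> q \<in> R" by blast
    then show ?thesis using card_star_le[OF F V, of q] A by (auto simp: \<R>_def)
  next
    case False
    have "\<exists>s1 s2 R1 R2. R1 \<in> \<R> \<and> R2 \<in> \<R> \<and> R1 \<inter> A = {s1} \<and> R2 \<inter> A = {s2} \<and> s1 \<noteq> s2"
    proof -
      obtain q where "q \<in> A" using neA by blast
      then obtain R1 where R1: "R1 \<in> \<R>" using False by blast
      then obtain s1 where s1: "R1 \<inter> A = {s1}" using wA by blast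
      then obtain R2 where R2: "R2 \<in> \<R>" "s1 \<notin> R2" using False by blast
      then obtain s2 where "R2 \<inter> A = {s2}" using wA by blast
      then show ?thesis using R1 R2 s1 by blast
    qed
    then obtain s1' s2' R1' R2' where *: "R1' \<in> \<R>" "R2' \<in> \<R>" "R1' \<inter> A = {s1'}" "R2' \<inter> A = {s2'}" "s1' \<noteq> s2'"
      by blast
    have "R1' \<noteq> R2'" using *(3-5) by blast
    then have "touch R1' R2'" using cyclic_thrackleD(3)[OF F R(1)[OF *(1)] R(1)[OF *(2)]] by blast
    \<comment> \<open>Swapping the two members swaps the sides of the chord, so the common side may
      be taken to be the arc from \<open>s1\<close> to \<open>s2\<close>.\<close>
    have "\<exists>s1 s2 R1 R2. R1 \<in> \<R> \<and> R2 \<in> \<R> \<and> R1 \<inter> A = {s1} \<and> R2 \<inter> A = {s2} \<and> s1 \<noteq> s2 \<and>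
       (\<forall>r\<in>R1. r = s1 \<or> cyc s1 r s2) \<and> (\<forall>r\<in>R2. r = s2 \<or> cyc s1 r s2)"
    proof -
      consider "\<forall>r\<in>R1'. r = s1' \<or> cyc s1' r s2'" "\<forall>r\<in>R2'. r = s2' \<or> cyc s1' r s2'"
        | "\<forall>r\<in>R1'. r = s1' \<or> cyc s2' r s1'" "\<forall>r\<in>R2'. r = s2' \<or> cyc s2' r s1'"
        using facing_arcs[OF nc[OF *(1)] nc[OF *(2)] *(3,4,5) \<open>touch R1' R2'\<close>] by blast
      then show ?thesis
      proof cases
        case 1
        then show ?thesis using * by (intro exI[of _ s1'] exI[of _ s2'] exI[of _ R1'] exI[of _ R2']) simp
      next
        case 2
        then show ?thesis using * by (intro exI[of _ s2'] exI[of _ s1'] exI[of _ R2'] exI[of _ R1']) simp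
      qed
    qed
    then obtain s1 s2 R1 R2 where R12: "R1 \<in> \<R>" "R2 \<in> \<R>" and i: "R1 \<inter> A = {s1}" "R2 \<inter> A = {s2}" and s12: "s1 \<noteq> s2"
      and arc: "\<And>r. r \<in> R1 \<Longrightarrow> r = s1 \<or> cyc s1 r s2" "\<And>r. r \<in> R2 \<Longrightarrow> r = s2 \<or> cyc s1 r s2" by blast
    have sA: "s1 \<in> A" "s2 \<in> A" using i by blast+
    have "R1 \<noteq> R2" using i s12 by blast
    then have t12: "touch R1 R2" using cyclic_thrackleD(3)[OF F R(1)[OF R12(1)] R(1)[OF R12(2)]] by blast
    \<comment> \<open>Neither member crosses a chord of \<open>A\<close>. A point \<open>s\<close>
      of \<open>A\<close> inside the arc would thus confine \<open>R1\<close> to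
      \<open>[s1, s)\<close> and \<open>R2\<close> to \<open>[s, s1)\<close>, and the two would not
      touch.\<close>
    have gap: "\<not> cyc s1 s s2" if sA': "s \<in> A" for s
    proof
      assume s: "cyc s1 s s2"
      have "s \<noteq> s1" "s \<noteq> s2" using s by auto
      then have sn: "s \<notin> R1" "s \<notin> R2" using i sA' by blast+
      have nc1: "\<not> (cyc s r s2 \<and> cyc s2 s1 s)" if "r \<in> R1" for r
        using nc[OF R12(1)] that sA' sA i unfolding chords_cross_def by blast
      have nc2: "\<not> (cyc s1 r s \<and> cyc s s2 s1)" if "r \<in> R2" for r
        using nc[OF R12(2)] that sA' sA i unfolding chords_cross_def by blast
      have arc1: "r = s1 \<or> cyc s1 r s" if r: "r \<in> R1" for r
      proof -
        have "r \<noteq> s" using r sn by blast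
        then show ?thesis using arc(1)[OF r] nc1[OF r] s unfolding cyc_def by (smt (verit))
      qed
      have arc2: "r = s \<or> cyc s r s1" if r: "r \<in> R2" for r
      proof -
        have "r \<noteq> s" using r sn by blast
        then show ?thesis using arc(2)[OF r] nc2[OF r] s unfolding cyc_def by (smt (verit))
      qed
      have "s1 \<noteq> s" using s by auto
      with arc1 arc2 have "\<not> touch R1 R2" by (rule not_touch_halfopen_arcs)
      then show False using t12 by blast
    qed
    \<comment> \<open>A member on the far side of the chord is separated from \<open>R2\<close> if
      it contains \<open>s1\<close>, and from \<open>R1\<close> otherwise. On the near side, the
      point where it meets \<open>A\<close> is an end of the arc by \<open>gap\<close>.\<close>
    have Rarc: "(s1 \<in> R \<or> s2 \<in> R) \<and> \<not> (s1 \<in> R \<and> s2 \<in> R) \<and> (\<forall>r\<in>R. r = s1 \<or> r = s2 \<or> cyc s1 r s2)"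
      if RR: "R \<in> \<R>" for R
    proof -
      obtain s where s: "R \<inter> A = {s}" using wA[OF RR] by blast
      have one: "\<not> (s1 \<in> R \<and> s2 \<in> R)" using s sA s12 by (metis IntI singletonD)
      have t1: "R \<noteq> R1 \<Longrightarrow> touch R R1" and t2: "R \<noteq> R2 \<Longrightarrow> touch R R2"
        using cyclic_thrackleD(3)[OF F R(1)[OF RR]] R(1)[OF R12(1)] R(1)[OF R12(2)] by blast+
      note side = chord_side[OF nc[OF RR] sA s12]
      have in_gap: "s1 \<in> R \<or> s2 \<in> R" if "\<forall>r\<in>R. r = s1 \<or> r = s2 \<or> cyc s1 r s2"
      proof -
        have "s \<in> R" "s \<in> A" using s by blast+
        then show ?thesis using that gap[of s] by metis
      qed
      have far: False if b: "\<forall>r\<in>R. r = s1 \<or> r = s2 \<or> cyc s2 r s1" and nR: "R \<noteq> R1" "R \<noteq> R2"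
      proof (cases "s1 \<in> R")
        case True
        then have "r = s1 \<or> cyc s2 r s1" if "r \<in> R" for r using b one that by metis
        then have "\<not> touch R R2" by (rule not_touch_halfopen_arcs_right) (use arc(2) s12 in auto)
        then show False using t2[OF nR(2)] by blast
      next
        case False
        then have "r = s2 \<or> cyc s2 r s1" if "r \<in> R" for r using b that by metis
        then have "\<not> touch R R1" by (rule not_touch_halfopen_arcs) (use arc(1) s12 in auto)
        then show False using t1[OF nR(1)] by blast
      qed
      have near: "\<forall>r\<in>R. r = s1 \<or> r = s2 \<or> cyc s1 r s2" if "R = R1 \<or> R = R2" using that arc by metis
      show ?thesis proof (cases "R = R1 \<or> R = R2")
        case True
        then show ?thesis using near in_gap one by metis
      next
        case False
        then have "\<forall>r\<in>R. r = s1 \<or> r = s2 \<or> cyc s1 r s2" using side far by metis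
        then show ?thesis using in_gap one by metis
      qed
    qed
    \<comment> \<open>The edge \<open>{s1, s2}\<close> can stand in for \<open>S\<close> against
      every member except \<open>T\<close>, which contains it. What remains is to drop or shrink
      \<open>T\<close>.\<close>
    have sub: "{s1, s2} \<subset> S" using sA S(2) unfolding A_def by blast
    have RS: "\<not> {s1, s2} \<subseteq> R" "\<not> R \<subseteq> {s1, s2}" "touch {s1, s2} R" if "R \<in> \<R>" for R
    proof -
      show "\<not> {s1, s2} \<subseteq> R" using Rarc[OF that] by blast
      show "\<not> R \<subseteq> {s1, s2}" using cyclic_thrackleD(2)[OF F R(1)[OF that] S(1) R(2)[OF that]] sub by blast
      show "touch {s1, s2} R" using Rarc[OF that] by (auto simp: touch_def)
    qed
    show ?thesis
    proof (cases "\<exists>z\<in>V. cyc s2 z s1")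
      case True
      then obtain z where z: "z \<in> V" "cyc s2 z s1" by blast
      let ?g = "\<lambda>X. if X = S then {s1, s2} else X"
      \<comment> \<open>Only \<open>S\<close> and \<open>T\<close> can have points beyond the chord.
        With \<open>S\<close> cut down to the edge and \<open>T\<close> dropped, \<open>z\<close> is
        free, and its deletion from \<open>V\<close> pays for \<open>T\<close>.\<close>
      have "card (F - {T}) \<le> card (V - {z})"
      proof (rule card_le_if_shrinkable[OF F V IH, of "F - {T}" ?g S "V - {z}"])
        show "?g X \<subseteq> X \<and> ?g X \<noteq> {}" if "X \<in> F - {T}" for X
          using that sub cyclic_thrackleD(1)[OF F, of X] by auto
        show "\<not> ?g X \<subseteq> ?g Y \<and> touch (?g X) (?g Y)" if XY: "X \<in> F - {T}" "Y \<in> F - {T}" "X \<noteq> Y" for X Y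
        proof -
          consider "X = S" "Y \<noteq> S" "Y \<in> \<R>" | "Y = S" "X \<noteq> S" "X \<in> \<R>" | "X \<noteq> S" "Y \<noteq> S"
            using XY by (auto simp: \<R>_def)
          then show ?thesis
          proof cases
            case 1
            then show ?thesis using RS[of Y] by simp
          next
            case 2
            then show ?thesis using RS[of X] touch_sym[OF RS(3)[of X]] by simp
          next
            case 3
            then show ?thesis using cyclic_thrackleD(2,3)[OF F _ _ XY(3)] XY(1,2) by simp
          qed
        qed
        show "?g X \<subseteq> V - {z}" if "X \<in> F - {T}" for X
        proof -
          have "z \<noteq> s1" "z \<noteq> s2" "\<not> cyc s1 z s2" using z(2) cyc_asym[OF z(2)] by auto
          then have "z \<notin> ?g X" using Rarc[of X] that by (auto simp: \<R>_def)
          moreover have "?g X \<subseteq> V" using that V(2) sub S by auto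
          ultimately show ?thesis by blast
        qed
      qed (use S T sub in auto)
      moreover have "card (V - {z}) < card V" using V(1) z(1) by (rule card_Diff1_less)
      moreover have "card F = Suc (card (F - {T}))" using finite_family[OF V] T(1) by (metis card_Suc_Diff1)
      ultimately show ?thesis by simp
    next
      case False
      have Varc: "z = s1 \<or> z = s2 \<or> cyc s1 z s2" if "z \<in> V" for z
        using that False cyc_total[of s1 z s2] s12 by metis
      \<comment> \<open>With no point of \<open>V\<close> beyond the chord and none of
        \<open>A\<close> inside the arc, \<open>S\<close> is the triangle on \<open>s1\<close>,
        \<open>x\<close>, \<open>s2\<close>, and the other points of \<open>T\<close> lie inside the
        arc like \<open>x\<close>.\<close>
      have A2: "A = {s1, s2}" 
      proof
        show "A \<subseteq> {s1, s2}"
        proof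
          fix s assume s: "s \<in> A"
          then have "s \<in> V" using A(1) S(1) V(2) by blast
          then show "s \<in> {s1, s2}" using Varc[of s] gap[OF s] by blast
        qed
      qed (use sA in simp)
      have x: "cyc s1 x s2"
      proof -
        have "x \<in> V" using S V(2) by blast
        moreover have "x \<noteq> s1" "x \<noteq> s2" using sA by (auto simp: A_def)
        ultimately show ?thesis using Varc[of x] by blast
      qed
      have y: "cyc s1 y s2" "y \<noteq> x" if "y \<in> T - A" for y
      proof -
        have "y \<in> V" using that T(1) V(2) by blast
        moreover have "y \<noteq> s1" "y \<noteq> s2" using that sA by auto
        ultimately show "cyc s1 y s2" using Varc[of y] by blast
        show "y \<noteq> x" using that xT by blast
      qed
      \<comment> \<open>If \<open>r\<close> came at or after both \<open>x\<close> and
        \<open>y\<close> on the arc, the chord from \<open>s1\<close> to \<open>r\<close> would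
        start inside the angles of \<open>S\<close> and of \<open>T\<close> at \<open>s1\<close>.
        The fact \<open>right\<close> is the mirror image at \<open>s2\<close>.\<close>
      have left: "cyc s1 r x \<or> cyc s1 r y" if RR: "R \<in> \<R>" "s1 \<in> R" and r: "r \<in> R" "r \<noteq> s1" and yT: "y \<in> T - A" for R r y
      proof (rule ccontr)
        assume n: "\<not> ?thesis"
        have r2: "cyc s1 r s2" using Rarc[OF RR(1)] RR(2) r by metis
        have "r = x \<or> cyc s1 x r" "r = y \<or> cyc s1 y r" using n r2 x y(1)[OF yT] unfolding cyc_def by (smt (verit))+
        then have "wedge s1 r S" "wedge s1 r T" using r2 A sA SA yT unfolding wedge_def by blast+
        then have "common_germ R S T" by (rule common_germI[OF RR(2) r(1) r(2)[symmetric]])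
        then show False using cyclic_thrackleD(4)[OF F R(1)[OF RR(1)] S(1) T(1)] R[OF RR(1)] T by blast
      qed
      have right: "cyc x r s2 \<or> cyc y r s2" if RR: "R \<in> \<R>" "s2 \<in> R" and r: "r \<in> R" "r \<noteq> s2" and yT: "y \<in> T - A" for R r y
      proof (rule ccontr)
        assume n: "\<not> ?thesis"
        have r2: "cyc s1 r s2" using Rarc[OF RR(1)] RR(2) r by metis
        have "r = x \<or> cyc s2 r x" "r = y \<or> cyc s2 r y" "cyc s2 s1 r"
          using n r2 x y(1)[OF yT] unfolding cyc_def by (smt (verit))+
        then have "wedge s2 r S" "wedge s2 r T" using A sA SA yT unfolding wedge_def by blast+
        then have "common_germ R S T" by (rule common_germI[OF RR(2) r(1) r(2)[symmetric]])
        then show False using cyclic_thrackleD(4)[OF F R(1)[OF RR(1)] S(1) T(1)] R[OF RR(1)] T by blast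
      qed
      have sR: "s1 \<in> R1" "s2 \<in> R2" using i by blast+
      obtain y0 where y0: "y0 \<in> T - A" using cyclic_thrackleD(2)[OF F T(1) S(1) T(2)] SA by blast
      note y0' = y[OF y0]
      have RT: "\<not> R \<subseteq> T" if "R \<in> \<R>" for R using cyclic_thrackleD(2)[OF F R(1)[OF that] T(1) R(3)[OF that]] .
      have y0s: "y0 \<noteq> s1" "y0 \<noteq> s2" using y0 sA by blast+
      have y0T: "s1 \<in> T" "s2 \<in> T" "y0 \<in> T" using sA A y0 by blast+
      consider (after) "\<forall>y\<in>T - A. cyc s1 x y" | (before) "\<forall>y\<in>T - A. cyc s1 y x"
        | (both) y1 y2 where "y1 \<in> T - A" "y2 \<in> T - A" "cyc s1 y1 x" "cyc s1 x y2"
      proof -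
        have "cyc s1 x y \<or> cyc s1 y x" if "y \<in> T - A" for y
          using x y[OF that] unfolding cyc_def by (smt (verit))
        then show thesis using that by blast
      qed
      then show ?thesis
      proof cases
        case after
        \<comment> \<open>All extra points of \<open>T\<close> come after \<open>x\<close>, so by
          \<open>left\<close> members at \<open>s1\<close> stay before \<open>y0\<close>. A member
          at \<open>s2\<close> must also have a point before \<open>y0\<close>, or \<open>R1\<close>
          would miss it; it then crosses the chord from \<open>s1\<close> to \<open>y0\<close>,
          which survives in \<open>T - {s2}\<close>.\<close>
        have "\<not> T - {s2} \<subseteq> R \<and> \<not> R \<subseteq> T - {s2} \<and> touch (T - {s2}) R" if RR: "R \<in> \<R>" for R
        proof (intro conjI)
          have n: "\<not> (s1 \<in> R \<and> y0 \<in> R)"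
          proof
            assume "s1 \<in> R \<and> y0 \<in> R"
            then have "cyc s1 y0 x" using left[OF RR _ _ y0s(1) y0] by auto
            moreover have "cyc s1 x y0" using after y0 by blast
            ultimately show False unfolding cyc_def by (smt (verit))
          qed
          then show "\<not> T - {s2} \<subseteq> R" using y0 y0s A(2) sA s12 by blast
          show "\<not> R \<subseteq> T - {s2}" using RT[OF RR] by blast
          show "touch (T - {s2}) R"
          proof (cases "s1 \<in> R")
            case True
            then show ?thesis using sA A s12 by (intro touch_shared[of s1]) auto
          next
            case False
            then have s2: "s2 \<in> R" "R \<noteq> R1" using Rarc[OF RR] sR by blast+
            have "\<exists>r\<in>R. cyc s1 r y0"
            proof (rule ccontr)
              assume n: "\<not> ?thesis"
              have "t = y0 \<or> cyc y0 t s1" if "t \<in> R" for t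
                using n that False cyc_total[of s1 t y0] y0s by metis
              moreover have "t = s1 \<or> cyc s1 t y0" if "t \<in> R1" for t
              proof -
                have "cyc s1 x y0" using after y0 by blast
                then show ?thesis using left[OF R12(1) sR(1) that _ y0] unfolding cyc_def by (smt (verit))
              qed
              ultimately have "\<not> touch R1 R" using y0s by (intro not_touch_halfopen_arcs[of R1 s1 y0 R]) auto
              then show False using cyclic_thrackleD(3)[OF F] R RR R12 s2 by blast
            qed
            then obtain r where "r \<in> R" "cyc s1 r y0" by blast
            moreover have "cyc y0 s2 s1" using cyc_rotate[OF y0'(1)] .
            moreover have "s1 \<in> T - {s2}" "y0 \<in> T - {s2}" using sA A s12 y0 y0s by blast+
            ultimately show ?thesis using s2 unfolding touch_def chords_cross_def by blast
          qed
        qed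
        then show ?thesis
          using RS sub y0T y0s s12 touch_shared[of s1 "{s1, s2}" "T - {s2}"]
          by (intro card_le_if_two_shrinkable[OF F V IH S(1) T(1) T(2)[symmetric], of "{s1, s2}" "T - {s2}"])
            (simp_all add: \<R>_def[symmetric], blast+)
      next
        case before
        \<comment> \<open>Mirror image: members at \<open>s2\<close> stay after \<open>y0\<close>,
          and \<open>T\<close> loses \<open>s1\<close> instead.\<close>
        have "\<not> T - {s1} \<subseteq> R \<and> \<not> R \<subseteq> T - {s1} \<and> touch (T - {s1}) R" if RR: "R \<in> \<R>" for R
        proof (intro conjI)
          have n: "\<not> (s2 \<in> R \<and> y0 \<in> R)"
          proof
            assume "s2 \<in> R \<and> y0 \<in> R"
            then have "cyc x y0 s2" using right[OF RR _ _ y0s(2) y0] by auto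
            moreover have "cyc s1 y0 x" using before y0 by blast
            ultimately show False using y0'(1) x unfolding cyc_def by (smt (verit))
          qed
          then show "\<not> T - {s1} \<subseteq> R" using y0 y0s A(2) sA s12 by blast
          show "\<not> R \<subseteq> T - {s1}" using RT[OF RR] by blast
          show "touch (T - {s1}) R"
          proof (cases "s2 \<in> R")
            case True
            then show ?thesis using sA A s12 by (intro touch_shared[of s2]) auto
          next
            case False
            then have s1: "s1 \<in> R" "R \<noteq> R2" using Rarc[OF RR] sR by blast+
            have "\<exists>r\<in>R. cyc y0 r s2"
            proof (rule ccontr)
              assume n: "\<not> ?thesis"
              have "t = y0 \<or> cyc s2 t y0" if "t \<in> R" for t
                using n that False cyc_total[of s2 t y0] y0s by metis
              moreover have "t = s2 \<or> cyc y0 t s2" if "t \<in> R2" for t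
              proof -
                have "cyc s1 y0 x" using before y0 by blast
                then show ?thesis using right[OF R12(2) sR(2) that _ y0] y0'(1) x unfolding cyc_def by (smt (verit))
              qed
              ultimately have "\<not> touch R R2" using y0s by (intro not_touch_halfopen_arcs_right[of R y0 s2 R2]) auto
              then show False using cyclic_thrackleD(3)[OF F] R RR R12 s1 by blast
            qed
            then obtain r where "r \<in> R" "cyc y0 r s2" by blast
            moreover have "cyc s2 s1 y0" using cyc_rotate[OF cyc_rotate[OF y0'(1)]] .
            moreover have "s2 \<in> T - {s1}" "y0 \<in> T - {s1}" using sA A s12 y0 y0s by blast+
            ultimately show ?thesis using s1 unfolding touch_def chords_cross_def by blast
          qed
        qed
        then show ?thesis
          using RS sub y0T y0s s12 touch_shared[of s2 "{s1, s2}" "T - {s1}"]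
          by (intro card_le_if_two_shrinkable[OF F V IH S(1) T(1) T(2)[symmetric], of "{s1, s2}" "T - {s1}"])
            (simp_all add: \<R>_def[symmetric], blast+)
      next
        case both
        \<comment> \<open>Extra points of \<open>T\<close> on both sides of \<open>x\<close> confine
          \<open>R1\<close> to \<open>[s1, x)\<close> and \<open>R2\<close> to
          \<open>[x, s1)\<close>, so that they could not touch.\<close>
        have "t = s1 \<or> cyc s1 t x" if "t \<in> R1" for t
          using left[OF R12(1) sR(1) that _ both(1)] both(3) unfolding cyc_def by (smt (verit))
        moreover have "t = x \<or> cyc x t s1" if "t \<in> R2" for t
          using right[OF R12(2) sR(2) that _ both(2)] both(4) x y(1)[OF both(2)] unfolding cyc_def by (smt (verit))
        moreover have "s1 \<noteq> x" using x by auto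
        ultimately have "\<not> touch R1 R2" by (rule not_touch_halfopen_arcs)
        then show ?thesis using t12 by blast
      qed
    qed
  qed
qed

subsection \<open>Irreducible thrackles\<close>

definition irreducible_thrackle :: "int set set \<Rightarrow> bool" where
  "irreducible_thrackle F \<longleftrightarrow> cyclic_thrackle F \<and>
     (\<forall>S\<in>F. \<forall>x\<in>S. \<exists>T\<in>F. T \<noteq> S \<and> \<not> touch (S - {x}) T)"

text \<open>Take \<open>T\<close> touching \<open>S\<close> but not \<open>S - {x}\<close>. It
  neither meets nor crosses the chord \<open>a b\<close>, so a single point of \<open>T\<close>
  outside the arc from \<open>b\<close> to \<open>a\<close> would put all of \<open>T\<close> beyond
  that chord. A chord of \<open>S\<close> at \<open>x\<close> crossing \<open>T\<close> could then
  be moved from \<open>x\<close> to \<open>a\<close> and would still cross, so \<open>T\<close>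
  would touch \<open>S - {x}\<close>.\<close>

lemma irreducible_witness:
  assumes F: "irreducible_thrackle F" and S: "S \<in> F" "x \<in> S"
  obtains T where "T \<in> F" "T \<noteq> S"
    "\<forall>a\<in>S. \<forall>b\<in>S. \<forall>t\<in>T. cyc b x a \<longrightarrow> cyc b t a"
proof -
  obtain T where T: "T \<in> F" "T \<noteq> S" and nt: "\<not> touch (S - {x}) T"
    using F S unfolding irreducible_thrackle_def by blast
  have t: "touch S T" using F S T cyclic_thrackleD(3) unfolding irreducible_thrackle_def by metis
  have "cyc b t a" if ab: "a \<in> S" "b \<in> S" "cyc b x a" and tT: "t \<in> T" for a b t
  proof (rule ccontr)
    assume n: "\<not> cyc b t a"
    have abx: "a \<in> S - {x}" "b \<in> S - {x}" using ab by auto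
    have far: "cyc a t' b" if "t' \<in> T" for t'
    proof -
      have neq: "t \<noteq> a" "t \<noteq> b" "t' \<noteq> a" "t' \<noteq> b" using nt abx tT that unfolding touch_def by blast+
      have "a \<noteq> b" using ab(3) by auto
      then have "cyc a t b" using n cyc_total[of a t b] neq by blast
      moreover have "\<not> (cyc a t b \<and> cyc b t' a)" using nt abx tT that unfolding touch_def chords_cross_def by blast
      ultimately show ?thesis using cyc_total[of a t' b] neq \<open>a \<noteq> b\<close> by blast
    qed
    have "x \<notin> T" using far[of x] cyc_asym[OF ab(3)] by blast
    then have "S \<inter> T = {}" using nt unfolding touch_def by blast
    then obtain p r q s where pr: "p \<in> S" "r \<in> S" "q \<in> T" "s \<in> T" "cyc p q r" "cyc r s p"
      using t unfolding touch_def chords_cross_def by blast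
    consider "p = x" | "r = x" | "p \<noteq> x" "r \<noteq> x" by blast
    then show False
    proof cases
      case 1
      then have "cyc a q r" "cyc r s a" "r \<noteq> x"
        using far[OF pr(3)] far[OF pr(4)] pr(5,6) ab(3) unfolding cyc_def by (smt (verit))+
      then show False using nt abx pr unfolding touch_def chords_cross_def by blast
    next
      case 2
      then have "cyc p q a" "cyc a s p" "p \<noteq> x"
        using far[OF pr(3)] far[OF pr(4)] pr(5,6) ab(3) unfolding cyc_def by (smt (verit))+
      then show False using nt abx pr unfolding touch_def chords_cross_def by blast
    next
      case 3
      then show False using nt pr unfolding touch_def chords_cross_def by blast
    qed
  qed
  then have "\<forall>a\<in>S. \<forall>b\<in>S. \<forall>t\<in>T. cyc b x a \<longrightarrow> cyc b t a" by simp
  with T show ?thesis by (rule that)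
qed

text \<open>If \<open>a\<close>, \<open>b\<close>, \<open>c\<close>, \<open>d\<close> are vertices
  in this order, the witnesses for \<open>b\<close> and \<open>d\<close> lie in the opposite open
  arcs of the chord \<open>a c\<close> and cannot touch each other.\<close>

lemma irreducible_card_le_3:
  assumes F: "irreducible_thrackle F" and S: "S \<in> F" "finite S"
  shows "card S \<le> 3"
proof (rule ccontr)
  assume "\<not> card S \<le> 3"
  then have "4 \<le> card S" by simp
  then obtain B where B: "B \<subseteq> S" "card B = 4" by (meson obtain_subset_with_card_n)
  have "\<exists>a b c d. {a, b, c, d} \<subseteq> B \<and> a < b \<and> b < c \<and> c < d"
  proof -
    have fB: "finite B" using B(1) S(2) finite_subset by blast
    define l where "l = sorted_list_of_set B"
    have l: "set l = B" "length l = 4" "sorted_wrt (<) l" using fB B(2) by (simp_all add: l_def)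
    then obtain a b c d where "l = [a, b, c, d]"
      by (auto simp: numeral_eq_Suc length_Suc_conv)
    then show ?thesis using l by auto
  qed
  then obtain a b c d where abcd: "a \<in> S" "b \<in> S" "c \<in> S" "d \<in> S" and lt: "a < b" "b < c" "c < d"
    using B(1) by blast
  obtain T where T: "T \<in> F" "T \<noteq> S" "\<forall>x\<in>S. \<forall>y\<in>S. \<forall>t\<in>T. cyc y b x \<longrightarrow> cyc y t x"
    using irreducible_witness[OF F S(1) abcd(2)] .
  obtain U where U: "U \<in> F" "U \<noteq> S" "\<forall>x\<in>S. \<forall>y\<in>S. \<forall>t\<in>U. cyc y d x \<longrightarrow> cyc y t x"
    using irreducible_witness[OF F S(1) abcd(4)] .
  have thr: "cyclic_thrackle F" using F unfolding irreducible_thrackle_def by blast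
  have Tarc: "cyc a t c" if "t \<in> T" for t 
  proof -
    have "cyc a b c" using lt by (simp add: cyc_def)
    then show ?thesis using T(3) abcd that by blast
  qed
  have Uarc: "cyc c u a" if "u \<in> U" for u 
  proof -
    have "cyc c d a" using lt by (simp add: cyc_def)
    then show ?thesis using U(3) abcd that by blast
  qed
  have "\<not> touch T U" using not_touch_closed_open_arcs[of T a c U] Tarc Uarc by blast
  moreover obtain t where "t \<in> T" using cyclic_thrackleD(1)[OF thr T(1)] by blast
  then have "T \<noteq> U" using Tarc[of t] Uarc[of t] cyc_asym by blast
  ultimately show False using cyclic_thrackleD(3)[OF thr T(1) U(1)] by blast
qed

section \<open>Triangles and edges at a common vertex\<close>

lemma ex_cyc_triangle:
  assumes "card S = 3" "a \<in> S"
  obtains b c where "S = {a, b, c}" "cyc a b c"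
proof -
  obtain b c where bc: "S = {a, b, c}" "a \<noteq> b" "a \<noteq> c" "b \<noteq> c"
  proof -
    have "card (S - {a}) = 2" using assms by (simp add: card_Diff_singleton)
    then obtain b c where "S - {a} = {b, c}" "b \<noteq> c" by (auto simp: card_2_iff)
    then show ?thesis using that assms(2) by blast
  qed
  show ?thesis
  proof (cases "cyc a b c")
    case True
    then show ?thesis using bc that by blast
  next
    case False
    then have "cyc a c b" using cyc_total[of a b c] bc cyc_rotate[of c b a] cyc_rotate[of b a c] by metis
    then show ?thesis using bc that[of c b] by blast
  qed
qed

text \<open>The witness for \<open>c\<close> lies in the open arc from \<open>b\<close> to
  \<open>a\<close>. If no point of \<open>R\<close> came after \<open>b\<close>, then
  \<open>R\<close> would lie in the closed arc from \<open>a\<close> to \<open>b\<close> and miss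
  this witness. The second claim is the mirror image, with the witness for \<open>b\<close>.\<close>

lemma triangle_neighbour_straddles:
  assumes F: "irreducible_thrackle F" and S: "{a, b, c} \<in> F" "cyc a b c"
    and R: "R \<in> F" "R \<noteq> {a, b, c}" "a \<in> R"
  shows "\<exists>r\<in>R. cyc a b r" "\<exists>r\<in>R. cyc a r c"
proof -
  have thr: "cyclic_thrackle F" using F unfolding irreducible_thrackle_def by blast
  show "\<exists>r\<in>R. cyc a b r"
  proof (rule ccontr)
    assume n: "\<not> ?thesis"
    obtain T where T: "T \<in> F" "\<And>t. t \<in> T \<Longrightarrow> cyc b t a"
    proof -
      obtain T where "T \<in> F" "T \<noteq> {a, b, c}"
        and *: "\<forall>x\<in>{a, b, c}. \<forall>y\<in>{a, b, c}. \<forall>t\<in>T. cyc y c x \<longrightarrow> cyc y t x"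
        by (rule irreducible_witness[OF F S(1), of c]) simp_all
      then show thesis using that[of T] cyc_rotate[OF S(2)] by simp
    qed
    have "r = a \<or> r = b \<or> cyc a r b" if "r \<in> R" for r
    proof -
      have "\<not> cyc a b r" using n that by blast
      then show ?thesis using S(2) unfolding cyc_def by (smt (verit))
    qed
    then have "\<not> touch R T" using not_touch_closed_open_arcs[of R a b T] T(2) by blast
    moreover have "R \<noteq> T" using T(2)[of a] R(3) by auto
    ultimately show False using cyclic_thrackleD(3)[OF thr R(1) T(1)] by blast
  qed
  show "\<exists>r\<in>R. cyc a r c"
  proof (rule ccontr)
    assume n: "\<not> ?thesis"
    obtain T where T: "T \<in> F" "\<And>t. t \<in> T \<Longrightarrow> cyc a t c"
    proof -
      obtain T where "T \<in> F" "T \<noteq> {a, b, c}"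
        and *: "\<forall>x\<in>{a, b, c}. \<forall>y\<in>{a, b, c}. \<forall>t\<in>T. cyc y b x \<longrightarrow> cyc y t x"
        by (rule irreducible_witness[OF F S(1), of b]) simp_all
      then show thesis using that[of T] S(2) by simp
    qed
    have "r = c \<or> r = a \<or> cyc c r a" if "r \<in> R" for r
    proof -
      have "\<not> cyc a r c" using n that by blast
      then show ?thesis using S(2) unfolding cyc_def by (smt (verit))
    qed
    then have "\<not> touch R T" using not_touch_closed_open_arcs[of R c a T] T(2) by blast
    moreover have "R \<noteq> T" using T(2)[of a] R(3) by auto
    ultimately show False using cyclic_thrackleD(3)[OF thr R(1) T(1)] by blast
  qed
qed

text \<open>Seen from \<open>a\<close>, the three angles are intervals. By
  \<open>triangle_neighbour_straddles\<close> each starts before any other ends, so the latest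
  starting side lies in all three and is a common germ.\<close>

lemma triangle_multiplicity_two:
  assumes F: "irreducible_thrackle F"
    and R: "R \<in> F" "card R = 3" "a \<in> R" and S: "S \<in> F" "card S = 3" "a \<in> S" and T: "T \<in> F" "card T = 3" "a \<in> T"
  shows "R = S \<or> R = T \<or> S = T"
proof (rule ccontr)
  assume "\<not> ?thesis"
  then have neq: "R \<noteq> S" "R \<noteq> T" "S \<noteq> T" by blast+
  have thr: "cyclic_thrackle F" using F unfolding irreducible_thrackle_def by blast
  obtain b1 c1 where R': "R = {a, b1, c1}" "cyc a b1 c1" using ex_cyc_triangle[OF R(2,3)] .
  obtain b2 c2 where S': "S = {a, b2, c2}" "cyc a b2 c2" using ex_cyc_triangle[OF S(2,3)] .
  obtain b3 c3 where T': "T = {a, b3, c3}" "cyc a b3 c3" using ex_cyc_triangle[OF T(2,3)] .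
  have overlap: "cyc a b c'" if "{a, b, c} \<in> F" "cyc a b c" "{a, b', c'} \<in> F" "cyc a b' c'" "{a, b', c'} \<noteq> {a, b, c}"
    for b c b' c'
    using triangle_neighbour_straddles(1)[OF F that(1,2,3,5)] that(4) unfolding cyc_def by (smt (verit) insert_iff singletonD)
  have o: "cyc a b1 c2" "cyc a b1 c3" "cyc a b2 c1" "cyc a b2 c3" "cyc a b3 c1" "cyc a b3 c2"
    using overlap R' S' T' R(1) S(1) T(1) neq by metis+
  obtain X r where X: "X \<in> {R, S, T}" "r \<in> X" "r \<noteq> a" and le: "r = b1 \<or> cyc a b1 r" "r = b2 \<or> cyc a b2 r" "r = b3 \<or> cyc a b3 r"
    and c: "cyc a r c1" "cyc a r c2" "cyc a r c3"
  proof -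
    have "(b1 = b2 \<or> cyc a b1 b2 \<or> cyc a b2 b1) \<and> (b1 = b3 \<or> cyc a b1 b3 \<or> cyc a b3 b1) \<and> (b2 = b3 \<or> cyc a b2 b3 \<or> cyc a b3 b2)"
      using R'(2) S'(2) T'(2) unfolding cyc_def by (smt (verit))
    then consider "b2 = b1 \<or> cyc a b2 b1" "b3 = b1 \<or> cyc a b3 b1" | "b1 = b2 \<or> cyc a b1 b2" "b3 = b2 \<or> cyc a b3 b2"
      | "b2 = b3 \<or> cyc a b2 b3" "b1 = b3 \<or> cyc a b1 b3"
      unfolding cyc_def by (smt (verit))
    moreover have neq_a: "b1 \<noteq> a" "b2 \<noteq> a" "b3 \<noteq> a" using R'(2) S'(2) T'(2) by auto
    ultimately show thesis
    proof cases
      case 1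
      then show ?thesis using that[of R b1] R' o neq_a by auto
    next
      case 2
      then show ?thesis using that[of S b2] S' o neq_a by auto
    next
      case 3
      then show ?thesis using that[of T b3] T' o neq_a by auto
    qed
  qed
  have w: "wedge a r R" "wedge a r S" "wedge a r T"
    using le c R'(1) S'(1) T'(1) unfolding wedge_def by blast+
  then have "a \<in> R" "a \<in> S" "a \<in> T" by (simp_all add: wedge_def)
  note germ = common_germI[OF _ X(2) X(3)[symmetric]]
  consider "X = R" | "X = S" | "X = T" using X(1) by blast
  then show False
  proof cases
    case 1
    then have "common_germ R S T" using germ[of S T] w \<open>a \<in> R\<close> by simp
    then show False using cyclic_thrackleD(4)[OF thr R(1) S(1) T(1) neq] by simp
  next
    case 2
    then have "common_germ S R T" using germ[of R T] w \<open>a \<in> S\<close> by simp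
    then show False using cyclic_thrackleD(4)[OF thr S(1) R(1) T(1) neq(1)[symmetric] neq(3,2)] by simp
  next
    case 3
    then have "common_germ T R S" using germ[of R S] w \<open>a \<in> T\<close> by simp
    then show False using cyclic_thrackleD(4)[OF thr T(1) R(1) S(1) neq(2,3)[symmetric] neq(1)] by simp
  qed
qed

text \<open>The far end \<open>r\<close> of the edge lies strictly inside the angle of the triangle
  at \<open>a\<close>. The witness \<open>T\<close> for \<open>a\<close> then completes a forbidden
  triple with edge and triangle: a common germ if it contains \<open>a\<close>, a common crossing
  otherwise.\<close>

lemma edge_avoids_triangle:
  assumes F: "irreducible_thrackle F"
    and E: "E \<in> F" "card E = 2" "a \<in> E" and S: "S \<in> F" "card S = 3" "a \<in> S"
  shows False
proof -
  have thr: "cyclic_thrackle F" using F unfolding irreducible_thrackle_def by blast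
  obtain b c where S': "S = {a, b, c}" "cyc a b c" using ex_cyc_triangle[OF S(2,3)] .
  obtain r where E': "E = {a, r}" "r \<noteq> a" using E by (auto simp: card_2_iff)
  have ES: "E \<noteq> S" using E(2) S(2) by auto
  have r: "cyc a b r" "cyc a r c"
  proof -
    have "\<exists>r\<in>E. cyc a b r" "\<exists>r\<in>E. cyc a r c"
      using triangle_neighbour_straddles[OF F, of a b c E] S S' E ES by simp_all
    then show "cyc a b r" "cyc a r c" using E' by auto
  qed
  obtain T where T: "T \<in> F" "T \<noteq> S" and Tarc: "\<And>t. t \<in> T \<Longrightarrow> cyc c t b"
  proof -
    obtain T where "T \<in> F" "T \<noteq> S" "\<forall>x\<in>S. \<forall>y\<in>S. \<forall>t\<in>T. cyc y a x \<longrightarrow> cyc y t x"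
      using irreducible_witness[OF F S(1,3)] .
    moreover have "cyc c a b" using cyc_rotate[OF cyc_rotate[OF S'(2)]] .
    ultimately show thesis using that[of T] S'(1) by simp
  qed
  have "\<not> cyc c r b" using r S'(2) unfolding cyc_def by (smt (verit))
  then have rT: "r \<notin> T" using Tarc by blast
  have ET: "E \<noteq> T" using rT E' by blast
  show False
  proof (cases "a \<in> T")
    case True
    obtain u v where "u \<in> T" "cyc a b u" "v \<in> T" "cyc a v c"
      using triangle_neighbour_straddles[OF F, of a b c T] S S' T True by blast
    moreover from this have "cyc a v r" "cyc a r u"
      using Tarc[of u] Tarc[of v] r S'(2) unfolding cyc_def by (smt (verit))+
    ultimately have "wedge a r T" using True unfolding wedge_def by blast
    moreover have "wedge a r S" using r S'(1) unfolding wedge_def by blast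
    ultimately have "common_germ E S T" using E' by (intro common_germI[of a E r]) simp_all
    then show False using cyclic_thrackleD(4)[OF thr E(1) S(1) T(1)] ES ET T(2) by blast
  next
    case False
    have "b \<notin> T" "c \<notin> T" using Tarc[of b] Tarc[of c] by auto
    then have "S \<inter> T = {}" using False S'(1) by blast
    then obtain p q s t where pq: "p \<in> S" "q \<in> S" "s \<in> T" "t \<in> T" "cyc p s q" "cyc q t p"
      using cyclic_thrackleD(3)[OF thr S(1) T(1) T(2)[symmetric]] unfolding touch_def chords_cross_def by blast
    \<comment> \<open>\<open>T\<close> lies in the arc from \<open>c\<close> to \<open>b\<close>
      around \<open>a\<close> and avoids the vertices of \<open>S\<close>, so a crossing with
      \<open>S\<close> requires points of \<open>T\<close> on either side of \<open>a\<close>. The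
      chord between them cuts off \<open>a\<close> and therefore crosses \<open>a r\<close> inside
      the triangle.\<close>
    have "\<exists>u\<in>T. \<exists>v\<in>T. cyc a v b \<and> cyc c u a"
    proof -
      have "cyc a s b \<and> cyc c t a \<or> cyc a t b \<and> cyc c s a"
        using pq(1,2,5,6) S' Tarc[OF pq(3)] Tarc[OF pq(4)] unfolding cyc_def by (smt (verit) insert_iff singletonD)
      then show ?thesis using pq by blast
    qed
    then obtain u v where uv: "u \<in> T" "v \<in> T" "cyc a v b" "cyc c u a" by blast
    then have "cyc a v r" "cyc r u a" "cyc a c u" using r unfolding cyc_def by (smt (verit))+
    then have "common_crossing E S T" using uv r E' S'(1) by (intro common_crossingI[of a E r u T v S b c]) simp_all
    then show False using cyclic_thrackleD(5)[OF thr E(1) S(1) T(1)] ES ET T(2) by blast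
  qed
qed

text \<open>Perles' argument: every edge is extremal at one of its endpoints, and each point has at most
  one extremal edge.\<close>

lemma card_edges_le:
  assumes W: "finite W" and E: "\<And>e. e \<in> E \<Longrightarrow> card e = 2 \<and> e \<subseteq> W"
    and t: "\<And>e e'. e \<in> E \<Longrightarrow> e' \<in> E \<Longrightarrow> e \<noteq> e' \<Longrightarrow> touch e e'"
  shows "card E \<le> card W"
proof -
  \<comment> \<open>An edge is extremal at \<open>a\<close> if its other end comes last among the
    neighbours of \<open>a\<close> when the circle is cut open at \<open>a\<close>.\<close>
  define extremal where "extremal a e \<longleftrightarrow> a \<in> e \<and> (\<forall>b c. e = {a, b} \<longrightarrow> {a, c} \<in> E \<longrightarrow> \<not> cyc a b c)" for a e
  have ex: "\<exists>a. extremal a e" if e: "e \<in> E" for e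
  proof (rule ccontr)
    assume n: "\<not> ?thesis"
    obtain a b where ab: "e = {a, b}" "a \<noteq> b" using E[OF e] by (auto simp: card_2_iff)
    obtain c where c: "{a, c} \<in> E" "cyc a b c" using n ab unfolding extremal_def by (metis doubleton_eq_iff insertI1)
    obtain d where d: "{b, d} \<in> E" "cyc b a d" using n ab unfolding extremal_def by (metis doubleton_eq_iff insertCI)
    \<comment> \<open>If \<open>e\<close> is extremal at neither end, \<open>c\<close> and
      \<open>d\<close> lie on opposite sides of the chord \<open>a b\<close>, and the edges
      \<open>a c\<close> and \<open>b d\<close> lie in complementary half-open arcs.\<close>
    have "\<not> touch {a, c} {b, d}"
      using c(2) d(2) by (intro not_touch_halfopen_arcs_right[of _ a b]) (auto simp: cyc_def)
    moreover have "{a, c} \<noteq> {b, d}" using c(2) d(2) ab(2) unfolding cyc_def by (auto simp: doubleton_eq_iff)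
    ultimately show False using t c(1) d(1) by blast
  qed
  define g where "g e = (SOME a. extremal a e)" for e
  have g: "extremal (g e) e" if "e \<in> E" for e using someI_ex[OF ex[OF that]] by (simp add: g_def)
  have "inj_on g E"
  proof (rule inj_onI)
    fix e e' assume ee: "e \<in> E" "e' \<in> E" "g e = g e'"
    define a where "a = g e"
    have x: "extremal a e" "extremal a e'" using g ee a_def by metis+
    then have "a \<in> e" "a \<in> e'" by (simp_all add: extremal_def)
    then obtain b b' where b: "e = {a, b}" "e' = {a, b'}" "a \<noteq> b" "a \<noteq> b'"
      using E[OF ee(1)] E[OF ee(2)] by (auto simp: card_2_iff)
    have "\<not> cyc a b b'" "\<not> cyc a b' b" using x b ee unfolding extremal_def by blast+
    then have "b = b'" using b(3,4) unfolding cyc_def by (smt (verit))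
    then show "e = e'" using b by simp
  qed
  moreover have "g ` E \<subseteq> W" using g E unfolding extremal_def by blast
  ultimately show ?thesis using W card_inj_on_le by blast
qed

lemma card_irreducible_le:
  assumes F: "irreducible_thrackle F" and V: "finite V" "\<Union>F \<subseteq> V"
  shows "card F \<le> card V"
proof -
  have thr: "cyclic_thrackle F" using F unfolding irreducible_thrackle_def by blast
  have fin: "finite S" if "S \<in> F" for S using V that by (meson Union_upper finite_subset)
  have finF: "finite F" using finite_family[OF V] .
  define E where "E = {S \<in> F. card S = 2}"
  define D where "D = {S \<in> F. card S = 3}"
  have "card S = 2 \<or> card S = 3" if S: "S \<in> F" for S
  proof -
    have "card S \<noteq> 0" using cyclic_thrackleD(1)[OF thr S] fin[OF S] by simp
    \<comment> \<open>A single point spans no chord, so a member touching \<open>{x}\<close>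
      contains \<open>x\<close>, against the antichain condition. Irreducibility provides such a
      member.\<close>
    moreover have "card S \<noteq> 1"
    proof
      assume "card S = 1"
      then obtain x where x: "S = {x}" by (auto simp: card_1_singleton_iff)
      then obtain T where T: "T \<in> F" "T \<noteq> S"
        using F S unfolding irreducible_thrackle_def by blast
      then have "touch S T" using cyclic_thrackleD(3)[OF thr S] by metis
      then have "x \<in> T" using x unfolding touch_def chords_cross_def cyc_def by auto
      then show False using cyclic_thrackleD(2)[OF thr S T(1)] T x by blast
    qed
    ultimately show ?thesis using irreducible_card_le_3[OF F S fin[OF S]] by linarith
  qed
  then have FED: "F = E \<union> D" "E \<inter> D = {}" by (auto simp: E_def D_def)
  have finW: "finite (\<Union>E)" "finite (\<Union>D)" using V(2) by (auto intro!: finite_subset[OF _ V(1)] simp del: finite_Union simp: E_def D_def)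
  have disj: "\<Union>E \<inter> \<Union>D = {}" using edge_avoids_triangle[OF F] unfolding E_def D_def by blast
  have "card E \<le> card (\<Union>E)"
    using cyclic_thrackleD(3)[OF thr] by (intro card_edges_le[OF finW(1)]) (auto simp: E_def)
  moreover have "card D \<le> card (\<Union>D)"
  proof (rule antichain_multiplicity_two[OF finW(2)])
    show "finite D" using finF by (simp add: D_def)
    show "S \<subseteq> \<Union>D \<and> S \<noteq> {}" if "S \<in> D" for S using that cyclic_thrackleD(1)[OF thr] by (auto simp: D_def)
    show "\<not> S \<subseteq> T" if "S \<in> D" "T \<in> D" "S \<noteq> T" for S T
      using that cyclic_thrackleD(2)[OF thr] by (simp add: D_def)
    show "R = S \<or> R = T \<or> S = T" if "R \<in> D" "S \<in> D" "T \<in> D" "x \<in> R" "x \<in> S" "x \<in> T" for x R S T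
      using that triangle_multiplicity_two[OF F, of R x S T] by (simp add: D_def)
  qed
  moreover have "card F = card E + card D" using FED finF by (metis card_Un_disjoint finite_Un)
  moreover have "card (\<Union>E) + card (\<Union>D) \<le> card V"
  proof -
    have "card (\<Union>E) + card (\<Union>D) = card (\<Union>E \<union> \<Union>D)" using card_Un_disjoint[OF finW disj] by simp
    also have "\<dots> \<le> card V" using V by (intro card_mono) (auto simp: E_def D_def)
    finally show ?thesis .
  qed
  ultimately show ?thesis by linarith
qed

lemma card_cyclic_thrackle_le:
  assumes "cyclic_thrackle F" "finite V" "\<Union>F \<subseteq> V"
  shows "card F \<le> card V"
  using assms
proof (induction "card V + total_size F" arbitrary: F V rule: less_induct)
  case less
  have IH: "card F' \<le> card V'" if "cyclic_thrackle F'" "finite V'" "\<Union>F' \<subseteq> V'"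
    "card V' + total_size F' < card V + total_size F" for F' V'
    using less(1)[OF that(4,1,2,3)] .
  show ?case
  proof (cases "irreducible_thrackle F")
    case True
    then show ?thesis using card_irreducible_le less.prems by blast
  next
    case False
    then obtain S x where S: "S \<in> F" "x \<in> S" and tch: "\<And>T. T \<in> F \<Longrightarrow> T \<noteq> S \<Longrightarrow> touch (S - {x}) T"
      using less.prems(1) unfolding irreducible_thrackle_def by blast
    show ?thesis
    \<comment> \<open>For a one-member family the touching condition is vacuous and
      \<open>S - {x}\<close> may be empty; there the point \<open>x\<close> itself gives
      \<open>1 \<le> card V\<close>.\<close>
    proof (cases "F = {S}")
      case True
      moreover have "V \<noteq> {}" using S less.prems(3) by blast
      ultimately show ?thesis using less.prems(2) by (simp add: Suc_le_eq card_gt_0_iff)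
    next
      case False
      then show ?thesis using card_le_if_removable_point[OF less.prems IH S _ tch] by blast
    qed
  qed
qed

subsection \<open>Points in convex position\<close>

text \<open>Twice the signed area of the triangle \<open>a b c\<close>, positive if it is traversed
  counterclockwise.\<close>

definition orient :: "real ^ 2 \<Rightarrow> real ^ 2 \<Rightarrow> real ^ 2 \<Rightarrow> real" where
  "orient a b c = (b$1 - a$1) * (c$2 - a$2) - (b$2 - a$2) * (c$1 - a$1)"

lemma orient_rotate: "orient a b c = orient b c a"
  by (simp add: orient_def algebra_simps)

lemma orient_swap: "orient a c b = - orient a b c"
  by (simp add: orient_def algebra_simps)

lemma vec2_eq_iff: "(x :: real^2) = y \<longleftrightarrow> x$1 = y$1 \<and> x$2 = y$2"
  by (simp add: vec_eq_iff forall_2)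

lemma orient_combination:
  assumes "s + t = 1"
  shows "orient a b (s *\<^sub>R x + t *\<^sub>R y) = s * orient a b x + t * orient a b y"
proof -
  have t: "t = 1 - s" using assms by simp
  show ?thesis unfolding t by (simp add: orient_def algebra_simps)
qed

lemma collinear_if_orient_zero:
  assumes "orient a b c = 0"
  shows "collinear {a, b, c}"
proof (cases "a = b")
  case True
  then show ?thesis by (simp add: collinear_2)
next
  case False
  define d where "d = b - a"
  have d: "d$1 * (c$2 - a$2) = d$2 * (c$1 - a$1)" using assms by (simp add: orient_def d_def)
  have "\<exists>k. c - a = k *\<^sub>R d"
  proof (cases "d$1 = 0")
    case True
    then have "d$2 \<noteq> 0" using False by (simp add: vec2_eq_iff d_def)
    with True d have "c - a = ((c$2 - a$2) / d$2) *\<^sub>R d" by (simp add: vec2_eq_iff)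
    then show ?thesis by blast
  next
    case nz: False
    then have "c - a = ((c$1 - a$1) / d$1) *\<^sub>R d" using d by (simp add: vec2_eq_iff field_simps)
    then show ?thesis by blast
  qed
  then obtain k where k: "c - a = k *\<^sub>R d" by blast
  have "collinear {0, b - a, c - a}"
    unfolding collinear_lemma using k d_def by blast
  then show ?thesis using collinear_3[of b a c] by (simp add: insert_commute)
qed

text \<open>By Cramer's rule the barycentric coordinates of \<open>x\<close> are proportional to its
  orientations with the three sides. Their sum is twice the signed area of \<open>a b c\<close>, and
  \<open>pos\<close> allows dividing by it.\<close>

lemma in_triangle_if_orient_nonneg:
  assumes "0 \<le> orient x a b" "0 \<le> orient x b c" "0 \<le> orient x c a"
    and pos: "0 < orient x a b + orient x b c + orient x c a"
  shows "x \<in> convex hull {a, b, c}"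
proof -
  define D where "D = orient x a b + orient x b c + orient x c a"
  have D: "D > 0" using pos D_def by simp
  have i: "D * x$1 = orient x b c * a$1 + orient x c a * b$1 + orient x a b * c$1"
       "D * x$2 = orient x b c * a$2 + orient x c a * b$2 + orient x a b * c$2"
    by (simp_all add: D_def orient_def algebra_simps)
  have "x = (orient x b c / D) *\<^sub>R a + (orient x c a / D) *\<^sub>R b + (orient x a b / D) *\<^sub>R c"
    using D i by (simp add: vec2_eq_iff field_simps)
  moreover have "orient x b c / D + orient x c a / D + orient x a b / D = 1"
  proof -
    have "orient x b c / D + orient x c a / D + orient x a b / D = (orient x b c + orient x c a + orient x a b) / D"
      by (simp add: add_divide_distrib)
    also have "orient x b c + orient x c a + orient x a b = D" by (simp add: D_def)
    finally show ?thesis using D by simp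
  qed
  ultimately show ?thesis
    unfolding convex_hull_3 using assms D by (smt (verit) divide_nonneg_pos mem_Collect_eq)
qed

section \<open>Cyclic numbering of points in convex position\<close>

locale convex_point_set =
  fixes P :: "(real ^ 2) set"
  assumes finite_P: "finite P"
    and general_position_P: "general_position P"
    and convex_position_P: "convex_position P"
begin

lemma orient_nonzero:
  assumes "a \<in> P" "b \<in> P" "c \<in> P" "a \<noteq> b" "b \<noteq> c" "a \<noteq> c"
  shows "orient a b c \<noteq> 0"
proof
  assume "orient a b c = 0"
  then have "collinear {a, b, c}" by (rule collinear_if_orient_zero)
  moreover have "card {a, b, c} = 3" using assms by simp
  moreover have "{a, b, c} \<subseteq> P" using assms by simp
  ultimately show False using general_position_P unfolding general_position_def by metis
qed

lemma notin_hull: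
  assumes "p \<in> P" "S \<subseteq> P" "p \<notin> S"
  shows "p \<notin> convex hull S"
proof -
  have "S \<subseteq> P - {p}" using assms by blast
  then have "convex hull S \<subseteq> convex hull (P - {p})" by (rule hull_mono)
  moreover have "p \<notin> convex hull (P - {p})"
    using convex_position_P assms(1) by (simp add: convex_position_def)
  ultimately show ?thesis by blast
qed

lemma notin_triangle:
  assumes "x \<in> P" "a \<in> P" "b \<in> P" "c \<in> P" "x \<notin> {a, b, c}"
  shows "\<not> (0 < orient x a b \<and> 0 < orient x b c \<and> 0 < orient x c a)"
proof
  assume "0 < orient x a b \<and> 0 < orient x b c \<and> 0 < orient x c a"
  then have "x \<in> convex hull {a, b, c}" by (intro in_triangle_if_orient_nonneg) simp_all
  moreover have "x \<notin> convex hull {a, b, c}" using assms by (intro notin_hull) simp_all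
  ultimately show False by blast
qed

lemma open_segment_notin:
  assumes "a \<in> P" "b \<in> P" "a \<noteq> b" "0 < t" "t < 1"
  shows "a + t *\<^sub>R (b - a) \<notin> P"
proof
  assume p: "a + t *\<^sub>R (b - a) \<in> P"
  have "a + t *\<^sub>R (b - a) \<in> convex hull {a, b}"
    unfolding convex_hull_2_alt using assms by auto
  moreover have "a + t *\<^sub>R (b - a) \<noteq> a" using assms by simp
  moreover have "a + t *\<^sub>R (b - a) \<noteq> b"
  proof
    assume "a + t *\<^sub>R (b - a) = b"
    moreover have "(1 - t) *\<^sub>R (b - a) = b - (a + t *\<^sub>R (b - a))" by (simp add: algebra_simps)
    ultimately show False using assms by simp
  qed
  ultimately show False using notin_hull[OF p, of "{a, b}"] assms by auto
qed

text \<open>The points are sorted by angle around one of them, \<open>o'\<close>, and numbered by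
  counting predecessors. A failure of transitivity would enclose \<open>o'\<close> in a triangle of
  points of \<open>P\<close>, against convex position.\<close>

lemma ex_cyclic_rank:
  obtains k :: "real ^ 2 \<Rightarrow> int" where "inj_on k P"
    and "\<forall>a\<in>P. \<forall>b\<in>P. \<forall>c\<in>P. k a < k b \<longrightarrow> k b < k c \<longrightarrow> 0 < orient a b c"
proof (cases "P = {}")
  case True
  then show ?thesis using that[of "\<lambda>_. 0"] by simp
next
  case False
  then obtain o' where o': "o' \<in> P" by blast
  define Q where "Q = P - {o'}"
  define less where "less a b \<longleftrightarrow> 0 < orient o' a b" for a b
  \<comment> \<open>The base point gets rank 0 and all others at least 1, so it comes first.\<close>
  define k where "k a = (if a = o' then 0 else 1 + int (card {b \<in> Q. less b a}))" for a
  have irr: "\<not> less a a" for a by (simp add: less_def orient_def)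
  have asym: "less a b \<Longrightarrow> \<not> less b a" for a b using orient_swap[of o' a b] by (simp add: less_def)
  have tot: "less a b \<or> less b a" if "a \<in> Q" "b \<in> Q" "a \<noteq> b" for a b
    using orient_nonzero[of o' a b] that o' orient_swap[of o' a b] by (auto simp: less_def Q_def)
  have tr: "less a c" if "less a b" "less b c" "a \<in> Q" "b \<in> Q" "c \<in> Q" for a b c
  proof (rule ccontr)
    assume n: "\<not> less a c"
    then have "less c a" using tot[of a c] asym that by blast
    then show False using notin_triangle[of o' a b c] that o' by (auto simp: less_def Q_def)
  qed
  have mono: "k a < k b" if "less a b" "a \<in> Q" "b \<in> Q" for a b
  proof -
    have "{x \<in> Q. less x a} \<subset> {x \<in> Q. less x b}"
      using tr that irr by blast
    then have "card {x \<in> Q. less x a} < card {x \<in> Q. less x b}"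
      by (rule psubset_card_mono[rotated]) (simp add: Q_def finite_P)
    then show ?thesis using that by (auto simp: k_def Q_def)
  qed
  have iff: "k a < k b \<longleftrightarrow> less a b" if "a \<in> Q" "b \<in> Q" for a b
    using mono tot that by (metis less_asym less_irrefl)
  have k0: "k a = 0 \<longleftrightarrow> a = o'" for a by (simp add: k_def)
  have "inj_on k P"
  proof (rule inj_onI)
    fix a b assume ab: "a \<in> P" "b \<in> P" "k a = k b"
    show "a = b"
    proof (cases "a = o' \<or> b = o'")
      case True
      then show ?thesis using ab k0 by metis
    next
      case False
      then show ?thesis using ab tot[of a b] mono[of a b] mono[of b a] by (auto simp: Q_def)
    qed
  qed
  moreover have "0 < orient a b c" if P: "a \<in> P" "b \<in> P" "c \<in> P" and lt: "k a < k b" "k b < k c" for a b c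
  proof -
    have "0 \<le> k a" by (simp add: k_def)
    then have Q: "b \<in> Q" "c \<in> Q" using P lt k0[of b] k0[of c] by (auto simp: Q_def)
    have bc: "less b c" using lt iff Q by blast
    show ?thesis
    proof (cases "a = o'")
      case True
      then show ?thesis using bc by (simp add: less_def)
    next
      case False
      then have aQ: "a \<in> Q" using P by (simp add: Q_def)
      then have ab: "less a b" using lt iff Q by blast
      have "a \<noteq> b" "b \<noteq> c" "a \<noteq> c" using lt by auto
      have "orient a b c \<noteq> 0" using orient_nonzero[OF P \<open>a \<noteq> b\<close> \<open>b \<noteq> c\<close> \<open>a \<noteq> c\<close>] .
      \<comment> \<open>Otherwise \<open>b\<close> would lie inside the triangle
        \<open>o' a c\<close>.\<close>
      moreover have "\<not> orient a b c < 0"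
      proof
        assume "orient a b c < 0"
        then have "0 < orient b a c" using orient_rotate[of a b c] orient_swap[of b a c] by simp
        moreover have "0 < orient b o' a" "0 < orient b c o'"
          using ab bc orient_rotate[of o' a b] orient_rotate[of a b o'] orient_rotate[of o' b c]
          by (simp_all add: less_def)
        ultimately show False using notin_triangle[of b o' a c] P o' Q \<open>a \<noteq> b\<close> \<open>b \<noteq> c\<close>
          by (auto simp: Q_def)
      qed
      ultimately show ?thesis by simp
    qed
  qed
  ultimately show ?thesis using that by metis
qed

end

section \<open>From hulls to conditions on cyclic order\<close>

locale ranked_convex_point_set = convex_point_set +
  fixes k :: "real ^ 2 \<Rightarrow> int"
  assumes inj_k: "inj_on k P"
    and orient_rank: "\<And>a b c. a \<in> P \<Longrightarrow> b \<in> P \<Longrightarrow> c \<in> P \<Longrightarrow> k a < k b \<Longrightarrow> k b < k c \<Longrightarrow> 0 < orient a b c"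
begin

lemma orient_pos_if_cyc:
  assumes "a \<in> P" "b \<in> P" "c \<in> P" "cyc (k a) (k b) (k c)"
  shows "0 < orient a b c"
proof -
  consider "k a < k b" "k b < k c" | "k b < k c" "k c < k a" | "k c < k a" "k a < k b"
    using assms(4) unfolding cyc_def by blast
  then show ?thesis
  proof cases
    case 1
    then show ?thesis using orient_rank assms(1-3) by simp
  next
    case 2
    then have "0 < orient b c a" using orient_rank assms(1-3) by simp
    then show ?thesis using orient_rotate[of a b c] by simp
  next
    case 3
    then have "0 < orient c a b" using orient_rank assms(1-3) by simp
    then show ?thesis using orient_rotate[of c a b] by simp
  qed
qed

text \<open>Without touching, \<open>T\<close> lies in one of the gaps that \<open>S\<close> leaves
  on the circle. The two points of \<open>S\<close> bounding this gap span a line that separates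
  \<open>S\<close> from \<open>T\<close>.\<close>

lemma touch_if_hulls_meet:
  assumes S: "S \<subseteq> P" and T: "T \<subseteq> P" and meet: "convex hull S \<inter> convex hull T \<noteq> {}"
  shows "touch (k ` S) (k ` T)"
proof (rule ccontr)
  assume nt: "\<not> touch (k ` S) (k ` T)"
  then have disj: "S \<inter> T = {}" unfolding touch_def by blast
  have nc: "\<not> (cyc (k a) (k b) (k c) \<and> cyc (k c) (k d) (k a))"
    if "a \<in> S" "c \<in> S" "b \<in> T" "d \<in> T" for a b c d
    using nt that unfolding touch_def chords_cross_def by blast
  have ne: "S \<noteq> {}" "T \<noteq> {}" using meet by auto
  have fin: "finite S" using S finite_P finite_subset by blast
  obtain t0 where t0: "t0 \<in> T" using ne by blast
  obtain N where N: "\<And>s. s \<in> S \<Longrightarrow> k s < N" "k t0 < N"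
    
  proof (rule that[of "1 + Max (insert (k t0) (k ` S))"])
    have "x < 1 + Max (insert (k t0) (k ` S))" if "x \<in> insert (k t0) (k ` S)" for x
      using Max_ge[OF _ that] fin by simp
    note * = this
    show "k t0 < 1 + Max (insert (k t0) (k ` S))" by (rule *) simp
    show "k s < 1 + Max (insert (k t0) (k ` S))" if "s \<in> S" for s by (rule *) (simp add: that)
  qed
  have neq: "k s \<noteq> k t" if "s \<in> S" "t \<in> T" for s t
    using inj_k that S T disj by (metis disjoint_iff inj_on_eq_iff subset_iff)
  define m where "m = Min (insert (k t0) (k ` S))"
  have m: "m \<le> k t0" "\<And>s. s \<in> S \<Longrightarrow> m \<le> k s" using fin by (simp_all add: m_def)
  define M where "M = N - m"
  \<comment> \<open>The circle is cut open at \<open>t0\<close>: ranks below \<open>k t0\<close> are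
    raised by \<open>M\<close>, which puts them past all the others. The first and last points of
    \<open>S\<close> in this order bound the gap containing \<open>t0\<close>.\<close>
  define \<phi> where "\<phi> s = (if k t0 < k s then k s else k s + M)" for s
  obtain a where a: "a \<in> S" "\<And>s. s \<in> S \<Longrightarrow> \<phi> a \<le> \<phi> s"
    
  proof -
    have "Min (\<phi> ` S) \<in> \<phi> ` S" using fin ne by simp
    then obtain a where "a \<in> S" "\<phi> a = Min (\<phi> ` S)" by auto
    then show ?thesis using that fin by simp
  qed
  obtain b where b: "b \<in> S" "\<And>s. s \<in> S \<Longrightarrow> \<phi> s \<le> \<phi> b"
  proof -
    have "Max (\<phi> ` S) \<in> \<phi> ` S" using fin ne by simp
    then obtain b where "b \<in> S" "\<phi> b = Max (\<phi> ` S)" by auto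
    then show ?thesis using that fin by simp
  qed
  have Sarc: "s = a \<or> s = b \<or> cyc (k a) (k s) (k b)" if s: "s \<in> S" for s
  proof -
    have "k s = k a \<or> k s = k b \<or> cyc (k a) (k s) (k b)"
      using a(2)[OF s] b(2)[OF s] a(2)[OF b(1)] N(1)[OF s] N(1)[OF a(1)] N(1)[OF b(1)] N(2)
        neq[OF s t0] neq[OF a(1) t0] neq[OF b(1) t0] m(1) m(2)[OF s] m(2)[OF a(1)] m(2)[OF b(1)]
      unfolding \<phi>_def cyc_def M_def by (smt (verit))
    moreover have "s \<in> P" "a \<in> P" "b \<in> P" using S s a b by blast+
    ultimately show ?thesis using inj_on_eq_iff[OF inj_k, of s a] inj_on_eq_iff[OF inj_k, of s b] by simp
  qed
  have abP: "a \<in> P" "b \<in> P" using S a(1) b(1) by blast+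
  show False
  proof (cases "a = b")
    \<comment> \<open>A single point spans no separating line; here convex position itself keeps
      \<open>a\<close> out of the hull of \<open>T\<close>.\<close>
    case True
    have "s = a" if "s \<in> S" for s using Sarc[OF that] True by simp
    then have "S = {a}" using a(1) by blast
    moreover have "a \<notin> convex hull T" using notin_hull[OF abP(1) T] disj a(1) by blast
    ultimately show False using meet by simp
  next
    case False
    then have kab: "k a \<noteq> k b" using inj_on_eq_iff[OF inj_k abP] by simp
    have t0arc: "cyc (k b) (k t0) (k a)"
      using a(2)[OF b(1)] neq[OF a(1) t0] neq[OF b(1) t0] kab N(1)[OF a(1)] N(1)[OF b(1)] N(2)
        m(1) m(2)[OF a(1)] m(2)[OF b(1)]
      unfolding \<phi>_def cyc_def M_def by (smt (verit))
    have Tarc: "cyc (k b) (k t) (k a)" if t: "t \<in> T" for t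
    proof -
      have "\<not> cyc (k a) (k t) (k b)" using nc[OF a(1) b(1) t t0] t0arc by blast
      then show ?thesis using cyc_total[of "k a" "k t" "k b"] kab neq[OF a(1) t] neq[OF b(1) t] by metis
    qed
    \<comment> \<open>The points \<open>a\<close> and \<open>b\<close> lie on the boundary line, so
      \<open>T\<close> goes into the open half plane and \<open>S\<close> into its closed
      complement; both are convex.\<close>
    define H where "H = {x. 0 < orient a b x}"
    have "convex H"
    proof (rule convexI)
      fix x y and u v :: real assume xy: "x \<in> H" "y \<in> H" and uv: "0 \<le> u" "0 \<le> v" "u + v = 1"
      have "u > 0 \<or> v > 0" using uv by linarith
      then have "0 < u * orient a b x + v * orient a b y"
        using xy uv by (auto simp: H_def intro: add_pos_nonneg add_nonneg_pos)
      then show "u *\<^sub>R x + v *\<^sub>R y \<in> H" by (simp add: H_def orient_combination[OF uv(3)])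
    qed
    moreover have "convex (- H)"
    proof (rule convexI)
      fix x y and u v :: real assume xy: "x \<in> - H" "y \<in> - H" and uv: "0 \<le> u" "0 \<le> v" "u + v = 1"
      then have "u * orient a b x + v * orient a b y \<le> 0"
        by (auto simp: H_def not_less intro: add_nonpos_nonpos mult_nonneg_nonpos)
      then show "u *\<^sub>R x + v *\<^sub>R y \<in> - H" by (simp add: H_def orient_combination[OF uv(3)])
    qed
    moreover have "T \<subseteq> H"
    proof
      fix t assume t: "t \<in> T"
      then have "0 < orient b t a" using orient_pos_if_cyc[OF abP(2) _ abP(1) Tarc[OF t]] T by blast
      then show "t \<in> H" using orient_rotate[of a b t] by (simp add: H_def)
    qed
    moreover have "S \<subseteq> - H"
    proof
      fix s assume s: "s \<in> S"
      have "orient a b s \<le> 0"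
      proof -
        consider "s = a" | "s = b" | "cyc (k a) (k s) (k b)" using Sarc[OF s] by blast
        then show ?thesis
        proof cases
          case 3
          then have "0 < orient a s b" using orient_pos_if_cyc[OF abP(1) _ abP(2)] s S by blast
          then show ?thesis using orient_swap[of a s b] by simp
        qed (simp_all add: orient_def)
      qed
      then show "s \<in> - H" by (simp add: H_def)
    qed
    ultimately have "convex hull T \<subseteq> H" "convex hull S \<subseteq> - H" by (simp_all add: hull_minimal)
    then show False using meet by blast
  qed
qed

text \<open>The direction from \<open>a\<close> to \<open>r\<close> is a positive combination of
  those to \<open>u\<close> and \<open>v\<close>, so a small step towards \<open>r\<close> stays in
  the triangle \<open>a u v\<close>; convexity then gives the whole initial segment.\<close>

lemma wedge_initial_segment:
  assumes P: "a \<in> P" "r \<in> P" "S \<subseteq> P" and w: "wedge (k a) (k r) (k ` S)"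
  obtains l where "0 < l" "\<And>t. 0 \<le> t \<Longrightarrow> t \<le> l \<Longrightarrow> a + t *\<^sub>R (r - a) \<in> convex hull S"
proof -
  have kS: "k x \<in> k ` S \<longleftrightarrow> x \<in> S" if "x \<in> P" for x
    using inj_k that P(3) by (simp add: inj_on_image_mem_iff)
  have aS: "a \<in> S" using w kS P(1) unfolding wedge_def by blast
  have "\<exists>l>0. a + l *\<^sub>R (r - a) \<in> convex hull S"
  proof (cases "r \<in> S")
    case True
    then have "a + 1 *\<^sub>R (r - a) \<in> convex hull S" by (simp add: hull_inc)
    then show ?thesis using zero_less_one by blast
  next
    case False
    then obtain u v where uv: "u \<in> S" "v \<in> S" "cyc (k a) (k u) (k r)" "cyc (k a) (k r) (k v)"
      using w kS[OF P(2)] unfolding wedge_def by blast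
    then have "cyc (k a) (k u) (k v)" by (auto simp: cyc_def)
    then have o: "0 < orient a u r" "0 < orient a r v" "0 < orient a u v"
      using orient_pos_if_cyc uv P by blast+
    \<comment> \<open>Dividing by the sum of the three orientations turns the Cramer identity for
      \<open>r - a\<close> into a convex combination. The coefficient \<alpha> is at once the step
      length towards \<open>r\<close> and the weight of \<open>a\<close>.\<close>
    define E where "E = orient a u v + orient a u r + orient a r v"
    have E: "E > 0" using o E_def by simp
    define \<alpha> \<beta> \<gamma> where "\<alpha> = orient a u v / E" and "\<beta> = orient a r v / E" and "\<gamma> = orient a u r / E"
    have "\<alpha> + \<beta> + \<gamma> = (orient a u v + orient a r v + orient a u r) / E"
      by (simp add: \<alpha>_def \<beta>_def \<gamma>_def add_divide_distrib)
    also have "orient a u v + orient a r v + orient a u r = E" by (simp add: E_def)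
    finally have sum: "\<alpha> + \<beta> + \<gamma> = 1" using E by simp
    have nonneg: "0 \<le> \<alpha>" "0 \<le> \<beta>" "0 \<le> \<gamma>" using o E by (simp_all add: \<alpha>_def \<beta>_def \<gamma>_def)
    have "orient a u v *\<^sub>R (r - a) = orient a r v *\<^sub>R (u - a) + orient a u r *\<^sub>R (v - a)"
      by (simp add: vec2_eq_iff orient_def algebra_simps)
    then have "(1 / E) *\<^sub>R (orient a u v *\<^sub>R (r - a)) = (1 / E) *\<^sub>R (orient a r v *\<^sub>R (u - a) + orient a u r *\<^sub>R (v - a))"
      by simp
    then have dir: "\<alpha> *\<^sub>R (r - a) = \<beta> *\<^sub>R (u - a) + \<gamma> *\<^sub>R (v - a)"
      by (simp add: \<alpha>_def \<beta>_def \<gamma>_def scaleR_add_right)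
    have "a + \<alpha> *\<^sub>R (r - a) = (\<alpha> + \<beta> + \<gamma>) *\<^sub>R a + (\<beta> *\<^sub>R (u - a) + \<gamma> *\<^sub>R (v - a))"
      by (simp add: sum dir)
    also have "\<dots> = \<alpha> *\<^sub>R a + \<beta> *\<^sub>R u + \<gamma> *\<^sub>R v" by (simp add: algebra_simps)
    finally have "a + \<alpha> *\<^sub>R (r - a) \<in> convex hull {a, u, v}"
      unfolding convex_hull_3 using nonneg sum by blast
    then have "a + \<alpha> *\<^sub>R (r - a) \<in> convex hull S"
      using hull_mono[of "{a, u, v}" S] aS uv by blast
    moreover have "0 < \<alpha>" using o E by (simp add: \<alpha>_def)
    ultimately show ?thesis by blast
  qed
  then obtain l where l: "l > 0" "a + l *\<^sub>R (r - a) \<in> convex hull S" by blast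
  show ?thesis
  proof (rule that[OF l(1)])
    fix t :: real assume t: "0 \<le> t" "t \<le> l"
    have "(1 - t / l) *\<^sub>R a + (t / l) *\<^sub>R (a + l *\<^sub>R (r - a)) \<in> convex hull S"
      using convexD[OF convex_convex_hull hull_inc[OF aS] l(2), of "1 - t / l" "t / l"] t l(1) by simp
    moreover have "(1 - t / l) *\<^sub>R a + (t / l) *\<^sub>R (a + l *\<^sub>R (r - a)) = a + t *\<^sub>R (r - a)"
      using l(1) by (simp add: algebra_simps)
    ultimately show "a + t *\<^sub>R (r - a) \<in> convex hull S" by simp
  qed
qed

lemma common_germ_outside:
  assumes P: "R \<subseteq> P" "S \<subseteq> P" "T \<subseteq> P" and g: "common_germ (k ` R) (k ` S) (k ` T)"
  shows "\<not> convex hull R \<inter> convex hull S \<inter> convex hull T \<subseteq> P"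
proof -
  obtain a r where ar: "a \<in> R" "r \<in> R" "k a \<noteq> k r"
    and w: "wedge (k a) (k r) (k ` S)" "wedge (k a) (k r) (k ` T)"
    using g unfolding common_germ_def by blast
  have arP: "a \<in> P" "r \<in> P" using ar P by auto
  have wR: "wedge (k a) (k r) (k ` R)" using ar by (simp add: wedge_def)
  obtain l1 where l1: "0 < l1" "\<And>t. 0 \<le> t \<Longrightarrow> t \<le> l1 \<Longrightarrow> a + t *\<^sub>R (r - a) \<in> convex hull R"
    using wedge_initial_segment[OF arP P(1) wR] by blast
  obtain l2 where l2: "0 < l2" "\<And>t. 0 \<le> t \<Longrightarrow> t \<le> l2 \<Longrightarrow> a + t *\<^sub>R (r - a) \<in> convex hull S"
    using wedge_initial_segment[OF arP P(2) w(1)] by blast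
  obtain l3 where l3: "0 < l3" "\<And>t. 0 \<le> t \<Longrightarrow> t \<le> l3 \<Longrightarrow> a + t *\<^sub>R (r - a) \<in> convex hull T"
    using wedge_initial_segment[OF arP P(3) w(2)] by blast
  \<comment> \<open>The bound 1/2 keeps the point strictly before \<open>r\<close>, in the open
    segment, which contains no point of \<open>P\<close>.\<close>
  define t where "t = min (1/2) (min l1 (min l2 l3))"
  have t: "0 < t" "t < 1" "t \<le> l1" "t \<le> l2" "t \<le> l3" using l1 l2 l3 by (auto simp: t_def)
  have "a + t *\<^sub>R (r - a) \<in> convex hull R \<inter> convex hull S \<inter> convex hull T"
    using t l1(2) l2(2) l3(2) by simp
  moreover have "a + t *\<^sub>R (r - a) \<notin> P" using open_segment_notin[of a r t] arP ar t by auto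
  ultimately show ?thesis by blast
qed

lemma common_crossing_outside:
  assumes P: "R \<subseteq> P" "S \<subseteq> P" "T \<subseteq> P" and g: "common_crossing (k ` R) (k ` S) (k ` T)"
  shows "\<not> convex hull R \<inter> convex hull S \<inter> convex hull T \<subseteq> P"
proof -
  have kS: "k x \<in> k ` S \<longleftrightarrow> x \<in> S" if "x \<in> P" for x
    using inj_k that P(2) by (simp add: inj_on_image_mem_iff)
  obtain p r u v where pr: "p \<in> R" "r \<in> R" and uv: "u \<in> T" "v \<in> T"
    and c: "cyc (k p) (k v) (k r)" "cyc (k r) (k u) (k p)" and kpS: "k p \<in> k ` S"
    and alt: "k r \<in> k ` S \<or> (\<exists>b\<in>S. \<exists>c\<in>S. cyc (k p) (k v) (k b) \<and> cyc (k p) (k b) (k r) \<and> cyc (k p) (k r) (k c) \<and> cyc (k p) (k c) (k u))"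
    using g unfolding common_crossing_def by blast
  have inP: "p \<in> P" "r \<in> P" "u \<in> P" "v \<in> P" using pr uv P by auto
  have pS: "p \<in> S" using kS kpS inP by blast
  \<comment> \<open>Each constant is twice the area of the triangle left when one vertex of the
    quadrilateral \<open>p v r u\<close> is omitted. They are the coefficients of the affine
    dependence \<open>A p + B r = C u + D v\<close> with \<open>A + B = C + D\<close>, whose
    normalized sides both give the crossing point \<open>X\<close>.\<close>
  define A where "A = orient v r u"
  define B where "B = orient u p v"
  define C where "C = orient p v r"
  define D where "D = orient r u p"
  have "cyc (k v) (k r) (k u)" "cyc (k u) (k p) (k v)" using c by (auto simp: cyc_def)
  then have pos: "0 < A" "0 < B" "0 < C" "0 < D"
    using orient_pos_if_cyc inP c by (simp_all add: A_def B_def C_def D_def)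
  have eq: "A + B = C + D" "A * p$1 + B * r$1 = C * u$1 + D * v$1" "A * p$2 + B * r$2 = C * u$2 + D * v$2"
    by (simp_all add: A_def B_def C_def D_def orient_def algebra_simps)
  define t where "t = B / (A + B)"
  define s where "s = D / (A + B)"
  have t: "0 < t" "t < 1" using pos by (simp_all add: t_def)
  have s: "0 < s" "s < 1" using pos eq by (simp_all add: s_def)
  define X where "X = p + t *\<^sub>R (r - p)"
  have X1: "X = (1 - t) *\<^sub>R p + t *\<^sub>R r" by (simp add: X_def algebra_simps)
  have st: "t * (A + B) = B" "s * (A + B) = D" using pos by (simp_all add: t_def s_def)
  have "(A + B) *\<^sub>R X = (A + B) *\<^sub>R ((1 - s) *\<^sub>R u + s *\<^sub>R v)"
  proof -
    have "(A + B) *\<^sub>R X = ((A + B) - t * (A + B)) *\<^sub>R p + (t * (A + B)) *\<^sub>R r"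
      by (simp add: X1 algebra_simps)
    also have "\<dots> = A *\<^sub>R p + B *\<^sub>R r" by (simp add: st)
    also have "\<dots> = C *\<^sub>R u + D *\<^sub>R v" using eq by (simp add: vec2_eq_iff)
    also have "C = (A + B) - s * (A + B)" using st eq by simp
    also have "((A + B) - s * (A + B)) *\<^sub>R u + D *\<^sub>R v = ((A + B) - s * (A + B)) *\<^sub>R u + (s * (A + B)) *\<^sub>R v"
      by (simp add: st)
    finally show ?thesis by (simp add: algebra_simps)
  qed
  then have X2: "X = (1 - s) *\<^sub>R u + s *\<^sub>R v" using pos by (simp add: scaleR_left_imp_eq)
  have seg: "X \<in> convex hull W" if "p \<in> W" "r \<in> W" for W
    unfolding X1 using convexD[OF convex_convex_hull, of p W r "1 - t" t] that t by (simp add: hull_inc)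
  have XR: "X \<in> convex hull R" using seg pr by blast
  have XT: "X \<in> convex hull T"
    unfolding X2 using convexD[OF convex_convex_hull, of u T v "1 - s" s] uv s by (simp add: hull_inc)
  have XS: "X \<in> convex hull S"
  proof (cases "r \<in> S")
    case True
    then show ?thesis using seg pS by blast
  next
    case False
    then obtain b c where bc: "b \<in> S" "c \<in> S" and cy: "cyc (k p) (k v) (k b)" "cyc (k p) (k b) (k r)"
      "cyc (k p) (k r) (k c)" "cyc (k p) (k c) (k u)"
      using alt kS inP by blast
    have bcP: "b \<in> P" "c \<in> P" using bc P by auto
    have "cyc (k c) (k p) (k r)" "cyc (k b) (k c) (k u)" "cyc (k b) (k c) (k v)"
      using cy unfolding cyc_def by (smt (verit))+
    then have o: "0 < orient c p r" "0 < orient b c u" "0 < orient b c v" "0 < orient p b r"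
      using inP bcP cy by (simp_all add: orient_pos_if_cyc)
    have z: "orient p b p = 0" "orient c p p = 0" by (simp_all add: orient_def)
    \<comment> \<open>For the two sides at \<open>p\<close>, \<open>X\<close> is regarded as a point
      of the chord \<open>p r\<close>; for the side \<open>b c\<close>, as a point of the chord
      \<open>u v\<close>.\<close>
    have "0 < orient p b X" unfolding X1 using o t z by (subst orient_combination) simp_all
    moreover have "0 < orient c p X" unfolding X1 using o t z by (subst orient_combination) simp_all
    moreover have "0 < orient b c X" unfolding X2 using o s by (subst orient_combination) (simp_all add: add_pos_pos)
    ultimately have "X \<in> convex hull {p, b, c}"
      by (intro in_triangle_if_orient_nonneg) (simp_all add: orient_rotate[of X])
    then show ?thesis using hull_mono[of "{p, b, c}" S] pS bc by blast
  qed
  have "p \<noteq> r" using c by (auto simp: cyc_def)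
  then have "X \<notin> P" unfolding X_def using open_segment_notin inP t by blast
  then show ?thesis using XR XS XT by blast
qed

lemma cyclic_thrackle_rank_image:
  assumes thr: "convex_hull_thrackle P \<S>" and ne: "{} \<notin> \<S>"
  shows "cyclic_thrackle ((`) k ` \<S>)"
proof -
  have sub: "S \<subseteq> P" if "S \<in> \<S>" for S
    using thr that by (simp add: convex_hull_thrackle_def)
  have hull: "convex hull S \<in> hulls \<S>" if "S \<in> \<S>" for S
    using that unfolding hulls_def by auto
  have neq: "convex hull S \<noteq> convex hull T" if "S \<in> \<S>" "T \<in> \<S>" "S \<noteq> T" for S T
    using thr that by (simp add: convex_hull_thrackle_def)
  have anti: "\<not> k ` S \<subseteq> k ` T" if "S \<in> \<S>" "T \<in> \<S>" "S \<noteq> T" for S T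
  proof
    assume "k ` S \<subseteq> k ` T"
    then have "S \<subseteq> T" using inj_on_image_subset_iff[OF inj_k sub[OF that(1)] sub[OF that(2)]] by simp
    then have "convex hull S \<subseteq> convex hull T" by (rule hull_mono)
    then show False
      using thr hull[OF that(1)] hull[OF that(2)] neq[OF that] by (simp add: convex_hull_thrackle_def)
  qed
  have tch: "touch (k ` S) (k ` T)" if "S \<in> \<S>" "T \<in> \<S>" "S \<noteq> T" for S T
  proof (rule touch_if_hulls_meet[OF sub[OF that(1)] sub[OF that(2)]])
    show "convex hull S \<inter> convex hull T \<noteq> {}"
      using thr hull[OF that(1)] hull[OF that(2)] neq[OF that] by (simp add: convex_hull_thrackle_def)
  qed
  have tri: "\<not> common_germ (k ` R) (k ` S) (k ` T)" "\<not> common_crossing (k ` R) (k ` S) (k ` T)"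
    if "R \<in> \<S>" "S \<in> \<S>" "T \<in> \<S>" "R \<noteq> S" "R \<noteq> T" "S \<noteq> T" for R S T
  proof -
    have "convex hull R \<inter> convex hull S \<inter> convex hull T \<subseteq> P"
      using thr hull[OF that(1)] hull[OF that(2)] hull[OF that(3)]
        neq[OF that(1,2,4)] neq[OF that(1,3,5)] neq[OF that(2,3,6)]
      by (simp add: convex_hull_thrackle_def)
    then show "\<not> common_germ (k ` R) (k ` S) (k ` T)" "\<not> common_crossing (k ` R) (k ` S) (k ` T)"
      using common_germ_outside[of R S T] common_crossing_outside[of R S T] sub that by metis+
  qed
  show ?thesis
    unfolding cyclic_thrackle_def
  proof (intro conjI ballI impI)
    show "{} \<notin> (`) k ` \<S>" using ne by auto
  next
    fix X Y assume "X \<in> (`) k ` \<S>" "Y \<in> (`) k ` \<S>" "X \<noteq> Y"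
    then obtain S T where "X = k ` S" "Y = k ` T" "S \<in> \<S>" "T \<in> \<S>" "S \<noteq> T" by blast
    then show "\<not> X \<subseteq> Y" "touch X Y" using anti tch by simp_all
  next
    fix X Y Z assume "X \<in> (`) k ` \<S>" "Y \<in> (`) k ` \<S>" "Z \<in> (`) k ` \<S>" "X \<noteq> Y \<and> X \<noteq> Z \<and> Y \<noteq> Z"
    moreover from this obtain R S T where "X = k ` R" "R \<in> \<S>" "Y = k ` S" "S \<in> \<S>" "Z = k ` T" "T \<in> \<S>"
      by (elim imageE)
    moreover from calculation have "R \<noteq> S" "R \<noteq> T" "S \<noteq> T" by auto
    ultimately show "\<not> common_germ X Y Z" "\<not> common_crossing X Y Z" using tri by simp_all
  qed
qed

end

theorem theorem2:
  fixes P :: "(real ^ 2) set" and \<S> :: "(real ^ 2) set set" and n :: nat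
  assumes "finite P" and "card P = n" and "n \<ge> 1"
    and "general_position P" and "convex_position P"
    and "convex_hull_thrackle P \<S>"
  shows "card (hulls \<S>) \<le> n \<and> card \<S> \<le> n"
proof -
  interpret convex_point_set P using assms(1,4,5) by unfold_locales
  have sub: "S \<subseteq> P" if "S \<in> \<S>" for S
    using assms(6) that by (simp add: convex_hull_thrackle_def)
  then have fin: "finite \<S>" using assms(1) by (meson Pow_iff finite_Pow_iff finite_subset subsetI)
  have "card \<S> \<le> n"
  proof (cases "{} \<in> \<S>")
    \<comment> \<open>The empty hull is contained in every other hull, so the family consists of the
      empty set alone, and \<open>n \<ge> 1\<close> gives the bound.\<close>
    case True
    have "S = {}" if S: "S \<in> \<S>" for S
    proof (rule ccontr)
      assume "S \<noteq> {}"
      moreover have "convex hull {} \<in> hulls \<S>" "convex hull S \<in> hulls \<S>"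
        using True S unfolding hulls_def by blast+
      ultimately show False using assms(6) by (force simp: convex_hull_thrackle_def)
    qed
    then have "\<S> = {{}}" using True by blast
    then show ?thesis using assms(3) by simp
  next
    case False
    obtain k :: "real ^ 2 \<Rightarrow> int" where k: "inj_on k P"
      "\<forall>a\<in>P. \<forall>b\<in>P. \<forall>c\<in>P. k a < k b \<longrightarrow> k b < k c \<longrightarrow> 0 < orient a b c"
      using ex_cyclic_rank .
    interpret ranked_convex_point_set P k using k by unfold_locales blast+
    have "inj_on ((`) k) \<S>"
      by (intro inj_onI) (simp add: inj_on_image_eq_iff[OF inj_k sub sub])
    then have "card \<S> = card ((`) k ` \<S>)" by (simp add: card_image)
    also have "\<dots> \<le> card (k ` P)"
      using sub assms(1)
      by (intro card_cyclic_thrackle_le cyclic_thrackle_rank_image[OF assms(6) False]) auto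
    also have "\<dots> = n" using card_image[OF inj_k] assms(2) by simp
    finally show ?thesis .
  qed
  moreover have "card (hulls \<S>) \<le> card \<S>"
  proof -
    have "hulls \<S> = (\<lambda>S. convex hull S) ` \<S>" by (auto simp: hulls_def)
    then show ?thesis using card_image_le[OF fin] by simp
  qed
  ultimately show ?thesis by simp
qed

end
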